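(* Let $R$ be a finite-dimensional regular quantum commutative algebra of quantum length $m$. Consider its Wedderburn--Malcev decomposition $R=B+J(R)$, where $B=B_1\oplus\cdots\oplus B_k$ is the direct sum (as algebras) of simple subalgebras of $R$, and put $q_i:=\sqrt{\dim B_i}$ for $1\le i\le k$. Then: (i) There exists $1\le \ell\le k$ such that $q_s\le q_\ell\le\sqrt{m}$ for all $1\le s\le k$. (ii) For any $1\le s\le k$ such that $1<q_s<q_\ell$, one has $\gcd(q_s,q_\ell)>1$.
   Context: $K$ is an algebraically closed field of characteristic different from $2$; all algebras are unital associative $K$-algebras. $J(R)$ denotes the Jacobson radical of $R$; in the Wedderburn--Malcev decomposition $B$ is a semisimple subalgebra of $R$ and $R=B\oplus J(R)$ as vector spaces. A regular quantum commutative decomposition of an algebra $R$, of quantum length $m$, is a vector space decomposition $R=R_1\oplus\cdots\oplus R_m$ such that, with $S=\{1,\dots,m\}$: (a) for every $n\in\mathbb{N}$ and every $(i_1,\dots,i_n)\in S^n$ there exist $a_j\in R_{i_j}$, $1\le j\le n$, with $a_1\cdots a_n\neq 0$; (b) there is a function $\theta\colon S\times S\to K^*$ such that $ab=\theta(i,j)ba$ for all $i,j\in S$, $a\in R_i$, $b\in R_j$. An algebra with a fixed such decomposition and $\theta$ is called a regular quantum commutative algebra. *)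

theory Defs
  imports
    "HOL-Computational_Algebra.Polynomial"
    "HOL-Library.FuncSet"
begin

text \<open>
  The ambient unital algebra is the whole type \<open>'r\<close>, with scalar multiplication \<open>scale\<close>.
\<close>

locale unital_algebra = vector_space scale
  for scale :: "'k::field \<Rightarrow> 'r::ring_1 \<Rightarrow> 'r" (infixr "*s" 75) +
  assumes scale_mult_left: "(c *s x) * y = c *s (x * y)"
    and scale_mult_right: "x * (c *s y) = c *s (x * y)"

definition internal_direct_sum :: "'i set \<Rightarrow> ('i \<Rightarrow> 'r::comm_monoid_add set) \<Rightarrow> 'r set \<Rightarrow> bool" where
  "internal_direct_sum I V W \<longleftrightarrow> bij_betw (\<lambda>f. \<Sum>i\<in>I. f i) (\<Pi>\<^sub>E i\<in>I. V i) W"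

definition left_ideal_of :: "'r::ring_1 set \<Rightarrow> 'r set \<Rightarrow> bool" where
  "left_ideal_of A L \<longleftrightarrow> L \<subseteq> A \<and> 0 \<in> L \<and> (\<forall>x\<in>L. \<forall>y\<in>L. x - y \<in> L) \<and>
     (\<forall>a\<in>A. \<forall>x\<in>L. a * x \<in> L)"

definition two_sided_ideal_of :: "'r::ring_1 set \<Rightarrow> 'r set \<Rightarrow> bool" where
  "two_sided_ideal_of A L \<longleftrightarrow> left_ideal_of A L \<and> (\<forall>a\<in>A. \<forall>x\<in>L. x * a \<in> L)"

definition maximal_left_ideal_of :: "'r::ring_1 set \<Rightarrow> 'r set \<Rightarrow> bool" where
  "maximal_left_ideal_of A M \<longleftrightarrow> left_ideal_of A M \<and> M \<noteq> A \<and>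
     (\<forall>L. left_ideal_of A L \<and> M \<subseteq> L \<longrightarrow> L = M \<or> L = A)"

definition jacobson_radical :: "'r::ring_1 set \<Rightarrow> 'r set" where
  "jacobson_radical A = A \<inter> \<Inter>{M. maximal_left_ideal_of A M}"

context unital_algebra
begin

definition finite_dimensional :: bool where
  "finite_dimensional \<longleftrightarrow> (\<exists>S. finite S \<and> span S = UNIV)"

text \<open>
  A subalgebra is unital, but its identity \<open>e\<close> need not be the identity of the ambient algebra:
  the simple summands of a semisimple algebra are subalgebras only in this sense.
  Since subalgebras have an identity, their one- and two-sided ring ideals
  are automatically linear subspaces.
\<close>
definition subalgebra :: "'r set \<Rightarrow> bool" where
  "subalgebra A \<longleftrightarrow> subspace A \<and> (\<forall>x\<in>A. \<forall>y\<in>A. x * y \<in> A) \<and>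
     (\<exists>e\<in>A. \<forall>x\<in>A. e * x = x \<and> x * e = x)"

definition simple_subalgebra :: "'r set \<Rightarrow> bool" where
  "simple_subalgebra A \<longleftrightarrow> subalgebra A \<and> A \<noteq> {0} \<and>
     (\<forall>L. two_sided_ideal_of A L \<longrightarrow> L = {0} \<or> L = A)"

text \<open>For the finite-dimensional algebras considered here, semisimple means zero radical.\<close>
definition semisimple_subalgebra :: "'r set \<Rightarrow> bool" where
  "semisimple_subalgebra A \<longleftrightarrow> subalgebra A \<and> jacobson_radical A = {0}"

definition wedderburn_malcev :: "'r set \<Rightarrow> bool" where
  "wedderburn_malcev B \<longleftrightarrow> semisimple_subalgebra B \<and>
     bij_betw (\<lambda>(b, r). b + r) (B \<times> jacobson_radical UNIV) UNIV"

text \<open>The second conjunct makes the sum direct as algebras, not merely as vector spaces.\<close>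
definition simple_decomposition :: "'r set \<Rightarrow> nat \<Rightarrow> (nat \<Rightarrow> 'r set) \<Rightarrow> bool" where
  "simple_decomposition B k Bs \<longleftrightarrow> internal_direct_sum {1..k} Bs B \<and>
     (\<forall>i\<in>{1..k}. \<forall>j\<in>{1..k}. i \<noteq> j \<longrightarrow> (\<forall>x\<in>Bs i. \<forall>y\<in>Bs j. x * y = 0)) \<and>
     (\<forall>i\<in>{1..k}. simple_subalgebra (Bs i))"

end

text \<open>Only the values of \<open>Rs\<close> and \<open>\<theta>\<close> at indices in \<open>{1..m}\<close> are relevant.\<close>
locale regular_quantum_commutative_algebra = unital_algebra scale
  for scale :: "'k::field \<Rightarrow> 'r::ring_1 \<Rightarrow> 'r" (infixr "*s" 75)
    and m :: nat
    and Rs :: "nat \<Rightarrow> 'r set"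
    and \<theta> :: "nat \<Rightarrow> nat \<Rightarrow> 'k" +
  assumes subspace_Rs: "i \<in> {1..m} \<Longrightarrow> subspace (Rs i)"
    and direct_sum_Rs: "internal_direct_sum {1..m} Rs UNIV"
    and regular: "set js \<subseteq> {1..m} \<Longrightarrow>
      \<exists>as. list_all2 (\<lambda>a j. a \<in> Rs j) as js \<and> prod_list as \<noteq> 0"
    and theta_nonzero: "i \<in> {1..m} \<Longrightarrow> j \<in> {1..m} \<Longrightarrow> \<theta> i j \<noteq> 0"
    and quantum_commutative: "i \<in> {1..m} \<Longrightarrow> j \<in> {1..m} \<Longrightarrow> a \<in> Rs i \<Longrightarrow> b \<in> Rs j \<Longrightarrow>
      a * b = \<theta> i j *s (b * a)"

end

theory Submission
  imports Defs "HOL-Library.Function_Algebras" "HOL-Algebra.Coset"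
begin

text \<open>
  A homogeneous element \<open>a\<close> satisfies \<open>aR = Ra\<close>. In a simple quotient \<open>B\<^sub>t\<close> of \<open>R\<close> its image is
  therefore zero or invertible, because the left ideal generated by the image is two-sided.
  Since \<open>K\<close> is algebraically closed, two elements of \<open>B\<^sub>t\<close> that commute with a spanning set
  up to the same scalars are proportional: otherwise a combination of them would be nonzero and singular. Hence each \<open>R\<^sub>i\<close> has an image of dimension at
  most one in \<open>B\<^sub>t\<close>, spanned by an invertible \<open>u\<^sub>i\<close> for \<open>i\<close> in the support \<open>I\<^sub>t\<close> of \<open>B\<^sub>t\<close>. This already
  gives \<open>dim B\<^sub>t \<le> m\<close>.

  A word \<open>w\<close> over \<open>I\<^sub>t\<close> has the character \<open>j \<mapsto> \<Prod>i\<leftarrow>w. \<theta> i j\<close>, which describes how the product of the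
  \<open>u\<^sub>i\<close> along \<open>w\<close> commutes with each \<open>u\<^sub>j\<close>. Words with the same character are proportional in \<open>B\<^sub>t\<close>, and
  words with different characters are independent, being joint eigenvectors of the conjugations by
  the \<open>u\<^sub>j\<close>. So the characters of words form a finite abelian group \<open>X\<^sub>t\<close> with \<open>card X\<^sub>t = dim B\<^sub>t\<close>
  (\<open>dim_eq_card_word_chars\<close>).

  The dimension is a square because \<open>\<theta>\<close> induces a nondegenerate alternating bicharacter on \<open>X\<^sub>t\<close>, and
  a finite abelian group that carries one has square order (\<open>alternating_bicharacter_square\<close>):
  it is an extension of a group of characters of a maximal isotropic subgroup by that subgroup,
  and independence of characters shows that the two have the same order.

  Regularity provides a summand \<open>B\<^sub>l\<close> whose support is all of \<open>{1..m}\<close>. If for every \<open>t\<close> some \<open>R\<^sub>i\<close> were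
  mapped to zero in \<open>B\<^sub>t\<close>, every product along one word containing all these \<open>i\<close>
  would lie in the radical, and since the radical is nilpotent all products
  along a high power of this word would vanish (\<open>full_support\<close>). For \<open>I \<subseteq> S\<close> the group of word characters of \<open>I\<close> is a subgroup of the restriction
  to \<open>I\<close> of that of \<open>S\<close>, so by Lagrange \<open>dim B\<^sub>t\<close> divides \<open>dim B\<^sub>l\<close> for every \<open>t\<close>. Thus \<open>q\<^sub>t\<close>
  divides \<open>q\<^sub>l\<close>, which yields both the maximality of \<open>q\<^sub>l\<close> and the condition on the greatest common
  divisors.
\<close>

section \<open>Characters and finite abelian groups\<close>

text \<open>
  Two eigenvectors with different eigenvalue systems are told apart by one operator \<open>T j\<close>. Applying
  \<open>T j - ev g j\<close> to a linear relation removes the term at \<open>g\<close> and changes the other coefficients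
  only by the factors \<open>ev f j - ev g j\<close>, so relations can be shortened until they are trivial.
\<close>
lemma (in vector_space) joint_eigenvectors_independent:
  fixes T :: "'j \<Rightarrow> 'b \<Rightarrow> 'b" and ev :: "'f \<Rightarrow> 'j \<Rightarrow> 'a"
  assumes linear: "\<And>j. j \<in> J \<Longrightarrow> Vector_Spaces.linear scale scale (T j)"
    and nonzero: "\<And>f. f \<in> F \<Longrightarrow> x f \<noteq> 0"
    and eigen: "\<And>f j. f \<in> F \<Longrightarrow> j \<in> J \<Longrightarrow> T j (x f) = scale (ev f j) (x f)"
    and sep: "\<And>f g. f \<in> F \<Longrightarrow> g \<in> F \<Longrightarrow> f \<noteq> g \<Longrightarrow> \<exists>j\<in>J. ev f j \<noteq> ev g j"
  shows "inj_on x F" and "independent (x ` F)"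
proof -
  have coeffs_zero: "\<forall>f\<in>E. c f = 0"
    if "finite E" "E \<subseteq> F" "(\<Sum>f\<in>E. scale (c f) (x f)) = 0" for E and c :: "'f \<Rightarrow> 'a"
    using that
  proof (induction E arbitrary: c rule: finite_induct)
    case empty
    then show ?case by simp
  next
    case (insert g E)
    have "c f = 0" if f: "f \<in> E" for f
    proof -
      have "f \<noteq> g" using f insert.hyps by blast
      then obtain j where j: "j \<in> J" "ev f j \<noteq> ev g j"
        using sep[of f g] f insert.prems(1) by blast
      interpret T: Vector_Spaces.linear scale scale "T j"
        by (rule linear[OF j(1)])
      have "0 = T j (\<Sum>f\<in>insert g E. scale (c f) (x f))"
        using insert.prems(2) by (simp add: T.zero)
      also have "\<dots> = (\<Sum>f\<in>insert g E. scale (c f * ev f j) (x f))"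
        unfolding T.sum using insert.prems(1) j(1)
        by (intro sum.cong) (auto simp: T.scale eigen subset_iff)
      finally have "(\<Sum>f\<in>insert g E. scale (c f * ev f j) (x f))
          - scale (ev g j) (\<Sum>f\<in>insert g E. scale (c f) (x f)) = 0"
        using insert.prems(2) by simp
      also have "(\<Sum>f\<in>insert g E. scale (c f * ev f j) (x f))
          - scale (ev g j) (\<Sum>f\<in>insert g E. scale (c f) (x f))
          = (\<Sum>f\<in>insert g E. scale (c f * (ev f j - ev g j)) (x f))"
        unfolding scale_sum_right sum_subtractf[symmetric]
        by (intro sum.cong refl) (simp add: right_diff_distrib scale_left_diff_distrib mult.commute)
      also have "\<dots> = (\<Sum>f\<in>E. scale (c f * (ev f j - ev g j)) (x f))"
        using insert.hyps by simp
      finally have "c f * (ev f j - ev g j) = 0"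
        using insert.IH[of "\<lambda>f. c f * (ev f j - ev g j)"] insert.prems(1) f by simp
      then show "c f = 0" using j(2) by simp
    qed
    moreover have "c g = 0"
      using calculation insert.prems insert.hyps nonzero[of g] by simp
    ultimately show ?case by simp
  qed
  show inj: "inj_on x F"
  proof (rule inj_onI, rule ccontr)
    fix f g
    assume fg: "f \<in> F" "g \<in> F" "x f = x g" "f \<noteq> g"
    then obtain j where j: "j \<in> J" "ev f j \<noteq> ev g j" using sep by blast
    have "scale (ev f j) (x f) = scale (ev g j) (x f)"
      using eigen[OF fg(1) j(1)] eigen[OF fg(2) j(1)] unfolding fg(3) by metis
    then show False using j(2) nonzero[OF fg(1)] by simp
  qed
  show "independent (x ` F)"
    unfolding independent_explicit_finite_subsets
  proof (intro allI impI ballI)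
    fix S u v
    assume S: "S \<subseteq> x ` F" "finite S" "(\<Sum>v\<in>S. scale (u v) v) = 0" "v \<in> S"
    obtain E where E: "E \<subseteq> F" "finite E" "S = x ` E"
      using finite_subset_image[OF S(2,1)] by blast
    have "(\<Sum>f\<in>E. scale (u (x f)) (x f)) = 0"
      using S(3) E inj by (simp add: sum.reindex inj_on_subset)
    then have "\<forall>f\<in>E. u (x f) = 0" by (rule coeffs_zero[OF E(2,1)])
    then show "u v = 0" using S(4) E(3) by blast
  qed
qed

text \<open>
  Dedekind's independence of characters, in the form of a bound: the functions \<open>b p\<close> are joint
  eigenvectors of the translations, with \<open>b p y\<close> as the eigenvalue of the translation by \<open>y\<close>. The
  operation \<open>m\<close> is a parameter because \<open>Q\<close> is at times a subgroup of an abstract group and at times a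
  group of functions.
\<close>
lemma card_characters_le:
  fixes b :: "'p \<Rightarrow> 'q \<Rightarrow> 'k::field"
  assumes fin: "finite Q" and ne: "Q \<noteq> {}"
    and closed: "\<And>x y. x \<in> Q \<Longrightarrow> y \<in> Q \<Longrightarrow> m x y \<in> Q"
    and mult: "\<And>p x y. p \<in> P \<Longrightarrow> x \<in> Q \<Longrightarrow> y \<in> Q \<Longrightarrow> b p (m x y) = b p x * b p y"
    and nonzero: "\<And>p x. p \<in> P \<Longrightarrow> x \<in> Q \<Longrightarrow> b p x \<noteq> 0"
    and sep: "\<And>p p'. p \<in> P \<Longrightarrow> p' \<in> P \<Longrightarrow> p \<noteq> p' \<Longrightarrow> \<exists>x\<in>Q. b p x \<noteq> b p' x"
  shows "card P \<le> card Q"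
proof -
  define sc :: "'k \<Rightarrow> ('q \<Rightarrow> 'k) \<Rightarrow> 'q \<Rightarrow> 'k" where "sc c f = (\<lambda>x. c * f x)" for c f
  interpret F: vector_space sc
    by unfold_locales (auto simp: sc_def fun_eq_iff algebra_simps)
  define chr where "chr p = (\<lambda>x. if x \<in> Q then b p x else 0)" for p
  define T :: "'q \<Rightarrow> ('q \<Rightarrow> 'k) \<Rightarrow> 'q \<Rightarrow> 'k"
    where "T y f = (\<lambda>x. if x \<in> Q then f (m x y) else 0)" for y f
  have lin: "Vector_Spaces.linear sc sc (T y)" for y
    by unfold_locales (auto simp: sc_def T_def fun_eq_iff)
  have chr0: "chr p \<noteq> 0" if "p \<in> P" for p
    using ne nonzero[OF that] by (auto simp: chr_def fun_eq_iff)
  have eig: "T y (chr p) = sc (b p y) (chr p)" if "p \<in> P" "y \<in> Q" for p y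
    using that closed mult by (auto simp: T_def chr_def sc_def fun_eq_iff mult.commute)
  note ind = F.joint_eigenvectors_independent[of Q T P chr b, OF lin chr0 eig sep]
  \<comment> \<open>The indicator functions of the points of Q span all functions supported in Q.\<close>
  define \<delta> :: "'q \<Rightarrow> 'q \<Rightarrow> 'k" where "\<delta> q = (\<lambda>x. if x = q then 1 else 0)" for q
  have "chr ` P \<subseteq> F.span (\<delta> ` Q)"
  proof (rule image_subsetI)
    fix p
    have "chr p = (\<Sum>q\<in>Q. sc (chr p q) (\<delta> q))"
    proof
      fix x
      have sum_at: "(\<Sum>q\<in>Q. sc (chr p q) (\<delta> q)) x = (\<Sum>q\<in>Q. sc (chr p q) (\<delta> q) x)"
        using fin by (induction Q rule: finite_induct) auto
      show "chr p x = (\<Sum>q\<in>Q. sc (chr p q) (\<delta> q)) x"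
        unfolding sum_at using fin by (simp add: sc_def \<delta>_def chr_def if_distrib cong: if_cong)
    qed
    also have "\<dots> \<in> F.span (\<delta> ` Q)"
      by (intro F.span_sum F.span_scale F.span_base) auto
    finally show "chr p \<in> F.span (\<delta> ` Q)" .
  qed
  then have "card (chr ` P) \<le> card (\<delta> ` Q)"
    using F.independent_span_bound[of "\<delta> ` Q" "chr ` P"] fin ind by blast
  also have "\<dots> \<le> card Q" using fin by (rule card_image_le)
  finally show ?thesis using ind by (simp add: card_image)
qed

lemma (in group_hom) order_eq_image_times_kernel:
  assumes "finite (carrier G)"
  shows "order G = card (h ` carrier G) * card (kernel G H h)"
proof -
  have "group_hom G (H\<lparr>carrier := h ` carrier G\<rparr>) h"
    using img_is_subgroup group_hom_axioms
    by (intro group_hom.intro group_hom_axioms.intro)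
       (auto simp: subgroup.subgroup_is_group hom_def)
  then interpret S: group_hom G "H\<lparr>carrier := h ` carrier G\<rparr>" h .
  have ker: "kernel G (H\<lparr>carrier := h ` carrier G\<rparr>) h = kernel G H h"
    by (simp add: kernel_def)
  have "card (rcosets (kernel G H h)) = card (h ` carrier G)"
    using S.FactGroup_iso_set unfolding is_iso_def iso_def ker
    by (auto simp: FactGroup_def dest: bij_betw_same_card)
  then show ?thesis
    using G.lagrange[OF subgroup_kernel] by simp
qed

text \<open>
  Characters are total functions that take the value 1 outside their intended domain, so that
  the group operation is pointwise multiplication everywhere.
\<close>
definition char_group :: "('j \<Rightarrow> 'k::field) set \<Rightarrow> ('j \<Rightarrow> 'k) monoid" where
  "char_group X = \<lparr>carrier = X, monoid.mult = (\<lambda>f g j. f j * g j), one = (\<lambda>_. 1)\<rparr>"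

text \<open>
  Closure under inverses comes for free: multiplication by a nowhere vanishing function is injective
  on the finite set \<open>X\<close>, hence permutes it and hits the constant 1.
\<close>
lemma char_group_comm_group:
  assumes fin: "finite X" and one: "(\<lambda>_. 1) \<in> X"
    and closed: "\<And>f g. f \<in> X \<Longrightarrow> g \<in> X \<Longrightarrow> (\<lambda>j. f j * g j) \<in> X"
    and nonzero: "\<And>f j. f \<in> X \<Longrightarrow> f j \<noteq> 0"
  shows "comm_group (char_group X)"
proof (rule comm_groupI)
  fix f
  assume "f \<in> carrier (char_group X)"
  then have f: "f \<in> X" by (simp add: char_group_def)
  have "inj_on (\<lambda>g j. g j * f j) X"
    using nonzero[OF f] by (auto simp: inj_on_def fun_eq_iff)
  moreover have "(\<lambda>g j. g j * f j) ` X \<subseteq> X" using closed f by blast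
  ultimately have "(\<lambda>g j. g j * f j) ` X = X" using fin by (simp add: endo_inj_surj)
  then obtain g where "g \<in> X" "(\<lambda>j. g j * f j) = (\<lambda>_. 1)"
    using one by (metis (no_types, lifting) imageE)
  then show "\<exists>g\<in>carrier (char_group X). g \<otimes>\<^bsub>char_group X\<^esub> f = \<one>\<^bsub>char_group X\<^esub>"
    by (auto simp: char_group_def)
qed (use one closed in \<open>auto simp: char_group_def mult_ac\<close>)

text \<open>
  A maximal isotropic subset \<open>L\<close> equals its own orthogonal complement, since any orthogonal
  element can be added to \<open>L\<close> as \<open>\<beta>\<close> is alternating; in particular \<open>L\<close> is a subgroup. Restricting
  \<open>\<beta> x\<close> to \<open>L\<close> is a homomorphism on \<open>G\<close> with kernel \<open>L\<close> and some image \<open>X\<close>. Elements of \<open>X\<close> are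
  characters of \<open>L\<close>, and by nondegeneracy elements of \<open>L\<close> are distinct characters of \<open>X\<close>. So
  \<open>card X = card L\<close> and \<open>order G = (card L)\<^sup>2\<close>.
\<close>
lemma alternating_bicharacter_square:
  fixes G (structure) and \<beta> :: "'g \<Rightarrow> 'g \<Rightarrow> 'k::field"
  assumes "comm_group G" and fin: "finite (carrier G)"
    and left: "\<And>x y z. x \<in> carrier G \<Longrightarrow> y \<in> carrier G \<Longrightarrow> z \<in> carrier G \<Longrightarrow>
      \<beta> (x \<otimes> y) z = \<beta> x z * \<beta> y z"
    and right: "\<And>x y z. x \<in> carrier G \<Longrightarrow> y \<in> carrier G \<Longrightarrow> z \<in> carrier G \<Longrightarrow>
      \<beta> z (x \<otimes> y) = \<beta> z x * \<beta> z y"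
    and alt: "\<And>x. x \<in> carrier G \<Longrightarrow> \<beta> x x = 1"
    and nondeg: "\<And>x. x \<in> carrier G \<Longrightarrow> (\<And>y. y \<in> carrier G \<Longrightarrow> \<beta> x y = 1) \<Longrightarrow> x = \<one>"
  shows "\<exists>n. order G = n\<^sup>2"
proof -
  interpret comm_group G by fact
  have skew: "\<beta> x y * \<beta> y x = 1" if "x \<in> carrier G" "y \<in> carrier G" for x y
    using alt[of "x \<otimes> y"] alt[of x] alt[of y] that by (simp add: left right mult.commute)
  then have nz: "\<beta> x y \<noteq> 0" if "x \<in> carrier G" "y \<in> carrier G" for x y
    using that by (metis mult_zero_left zero_neq_one)
  define iso where "iso L \<longleftrightarrow> L \<subseteq> carrier G \<and> (\<forall>x\<in>L. \<forall>y\<in>L. \<beta> x y = 1)" for L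
  have "{L. iso L} \<subseteq> Pow (carrier G)" by (auto simp: iso_def)
  then have "finite {L. iso L}" using fin by (meson finite_Pow_iff finite_subset)
  moreover have "{} \<in> {L. iso L}" by (simp add: iso_def)
  ultimately obtain L where L: "iso L" and max: "\<And>L'. iso L' \<Longrightarrow> L \<subseteq> L' \<Longrightarrow> L = L'"
    using finite_has_maximal[of "{L. iso L}"] by blast
  have LG: "L \<subseteq> carrier G" using L by (simp add: iso_def)
  have finL: "finite L" using LG fin by (rule finite_subset)
  have perp: "x \<in> L \<longleftrightarrow> x \<in> carrier G \<and> (\<forall>y\<in>L. \<beta> x y = 1)" for x
  proof
    assume x: "x \<in> carrier G \<and> (\<forall>y\<in>L. \<beta> x y = 1)"
    moreover have "\<beta> y x = 1" if "y \<in> L" for y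
      using skew[of x y] x that LG by auto
    ultimately have "iso (insert x L)"
      using L alt by (auto simp: iso_def)
    then show "x \<in> L" using max[of "insert x L"] by blast
  qed (use L in \<open>auto simp: iso_def\<close>)
  define h where "h x = (\<lambda>y. if y \<in> L then \<beta> x y else 1)" for x
  define X where "X = h ` carrier G"
  have one_left: "\<beta> \<one> y = 1" if "y \<in> carrier G" for y
    using left[of \<one> \<one> y] nz[of \<one> y] that by simp
  have h_mult: "h (x \<otimes> y) = (\<lambda>j. h x j * h y j)" if "x \<in> carrier G" "y \<in> carrier G" for x y
    using that LG by (auto simp: h_def left fun_eq_iff)
  have h_one: "h \<one> = (\<lambda>_. 1)" using LG one_left by (auto simp: h_def fun_eq_iff)
  have X_group: "comm_group (char_group X)"
  proof (rule char_group_comm_group)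
    show "finite X" by (simp add: X_def fin)
    show "(\<lambda>_. 1) \<in> X" using h_one by (metis X_def imageI one_closed)
    show "(\<lambda>j. f j * g j) \<in> X" if "f \<in> X" "g \<in> X" for f g
    proof -
      obtain x y where "x \<in> carrier G" "y \<in> carrier G" "f = h x" "g = h y"
        using \<open>f \<in> X\<close> \<open>g \<in> X\<close> by (auto simp: X_def)
      then show ?thesis
        unfolding X_def by (intro image_eqI[of _ h "x \<otimes> y"]) (simp_all add: h_mult)
    qed
    show "f j \<noteq> 0" if "f \<in> X" for f j
      using that LG nz by (auto simp: X_def h_def split: if_splits)
  qed
  interpret X: comm_group "char_group X" by (rule X_group)
  interpret h: group_hom G "char_group X" h
    using X.is_group is_group
    by (intro group_hom.intro group_hom_axioms.intro homI)
       (simp_all add: char_group_def X_def h_mult)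
  have "kernel G (char_group X) h = L"
  proof (rule Set.set_eqI)
    fix x
    have "h x = (\<lambda>_. 1) \<longleftrightarrow> (\<forall>y\<in>L. \<beta> x y = 1)" by (auto simp: h_def fun_eq_iff)
    then show "x \<in> kernel G (char_group X) h \<longleftrightarrow> x \<in> L"
      unfolding kernel_def char_group_def perp[of x] by simp
  qed
  then have order: "order G = card X * card L"
    using h.order_eq_image_times_kernel[OF fin] by (simp add: X_def)
  have one_L: "\<one> \<in> L" unfolding perp[of \<one>] using one_left LG by auto
  have L_closed: "x \<otimes> y \<in> L" if "x \<in> L" "y \<in> L" for x y
    using that LG L unfolding perp[of "x \<otimes> y"] iso_def by (auto simp: left subset_iff)
  have "card X \<le> card L"
  proof (rule card_characters_le[where b = "\<lambda>f. f" and m = "(\<otimes>)"])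
    show "\<exists>x\<in>L. f x \<noteq> g x" if "f \<in> X" "g \<in> X" "f \<noteq> g" for f g
    proof -
      obtain x where "f x \<noteq> g x" using \<open>f \<noteq> g\<close> by blast
      moreover have "x \<in> L" using calculation that by (auto simp: X_def h_def split: if_splits)
      ultimately show ?thesis by blast
    qed
    show "f (x \<otimes> y) = f x * f y" if "f \<in> X" "x \<in> L" "y \<in> L" for f x y
      using that L_closed LG by (auto simp: X_def h_def right subset_iff)
    show "f x \<noteq> 0" if "f \<in> X" for f x using that LG nz by (auto simp: X_def h_def split: if_splits)
  qed (use finL one_L L_closed in auto)
  moreover have "card L \<le> card X"
  proof (rule card_characters_le[where b = "\<lambda>l f. f l" and m = "\<lambda>f g j. f j * g j"])
    show "finite X" by (simp add: X_def fin)
    show "X \<noteq> {}" by (auto simp: X_def)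
    show "(\<lambda>j. f j * g j) \<in> X" if "f \<in> X" "g \<in> X" for f g
      using X.m_closed[of f g] that by (simp add: char_group_def)
    show "f l \<noteq> 0" if "f \<in> X" for f l using that LG nz by (auto simp: X_def h_def split: if_splits)
    show "\<exists>f\<in>X. f l \<noteq> f l'" if l: "l \<in> L" "l' \<in> L" "l \<noteq> l'" for l l'
    proof (rule ccontr)
      assume "\<not> (\<exists>f\<in>X. f l \<noteq> f l')"
      then have eq: "\<beta> g l = \<beta> g l'" if "g \<in> carrier G" for g
        using that l by (auto simp: X_def h_def)
      have lG: "l \<in> carrier G" "l' \<in> carrier G" using l LG by auto
      have "l \<otimes> inv l' = \<one>"
      proof (rule nondeg)
        fix y
        assume y: "y \<in> carrier G"
        have "\<beta> l y = \<beta> l' y"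
          using skew[of y l] skew[of y l'] eq[OF y] nz[of y l'] lG y
          by (metis mult_left_cancel)
        then have "\<beta> (l \<otimes> inv l') y = \<beta> l' y * \<beta> (inv l') y"
          using lG y by (simp add: left)
        also have "\<dots> = \<beta> (l' \<otimes> inv l') y"
          using lG y by (intro left[symmetric]) auto
        finally show "\<beta> (l \<otimes> inv l') y = 1" using lG y one_left by simp
      qed (use lG in simp)
      then show False using l(3) lG by (metis inv_equality inv_inv inv_closed)
    qed
  qed auto
  ultimately show ?thesis using order by (auto simp: power2_eq_square)
qed

section \<open>Finite-dimensional algebras and their radical\<close>

locale finite_dimensional_algebra =
  unital_algebra scale + finite_dimensional_vector_space scale Basis
  for scale :: "'k::field \<Rightarrow> 'r::ring_1 \<Rightarrow> 'r" (infixr "*s" 75) and Basis :: "'r set"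
begin

lemma linear_mult_left: "Vector_Spaces.linear scale scale ((*) a)"
  by unfold_locales (simp_all add: distrib_left scale_mult_right)

lemma left_ideal_mult: "left_ideal_of UNIV L \<Longrightarrow> x \<in> L \<Longrightarrow> a * x \<in> L"
  by (simp add: left_ideal_of_def)

text \<open>
  The ambient algebra has an identity, so scalars act through multiplication by \<open>c *s 1\<close>.
\<close>
lemma left_ideal_subspace:
  assumes "left_ideal_of UNIV L"
  shows "subspace L"
proof (rule subspaceI)
  show "0 \<in> L" using assms by (simp add: left_ideal_of_def)
  show "x + y \<in> L" if "x \<in> L" "y \<in> L" for x y
  proof -
    have "x - (0 - y) \<in> L" using assms that unfolding left_ideal_of_def by blast
    then show ?thesis by simp
  qed
  show "c *s x \<in> L" if "x \<in> L" for c x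
  proof -
    have "(c *s 1) * x \<in> L" using assms that by (rule left_ideal_mult)
    then show ?thesis by (simp add: scale_mult_left)
  qed
qed

text \<open>
  Finite dimension replaces Zorn's lemma: a proper left ideal of largest dimension among those
  containing \<open>L\<close> is maximal.
\<close>
lemma maximal_left_ideal_exists:
  fixes L :: "'r set"
  assumes L: "left_ideal_of UNIV L" and "1 \<notin> L"
  shows "\<exists>M. maximal_left_ideal_of UNIV M \<and> L \<subseteq> M"
proof -
  define P where "P M \<longleftrightarrow> left_ideal_of UNIV M \<and> 1 \<notin> M \<and> L \<subseteq> M" for M :: "'r set"
  have PL: "P L" using assms by (simp add: P_def)
  have bound: "\<forall>M. P M \<longrightarrow> dim M < Suc dimension"
    by (simp add: dim_subset_UNIV less_Suc_eq_le del: dim_UNIV)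
  obtain M where M: "P M" and max: "\<And>N. P N \<Longrightarrow> dim N \<le> dim M"
    using ex_has_greatest_nat[OF PL bound] by auto
  have "maximal_left_ideal_of UNIV M"
    unfolding maximal_left_ideal_of_def
  proof (intro conjI allI impI)
    show "left_ideal_of UNIV M" "M \<noteq> UNIV" using M by (auto simp: P_def)
    fix N
    assume N: "left_ideal_of UNIV N \<and> M \<subseteq> N"
    show "N = M \<or> N = UNIV"
    proof (cases "1 \<in> N")
      case True
      have "a * 1 \<in> N" for a using N True by (intro left_ideal_mult) simp_all
      then show ?thesis by auto
    next
      case False
      then have "P N" using N M by (auto simp: P_def)
      then show ?thesis
        using subspace_dim_equal[of M N] max N M left_ideal_subspace by (auto simp: P_def)
    qed
  qed
  then show ?thesis using M by (auto simp: P_def)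
qed

abbreviation radical :: "'r set" where "radical \<equiv> jacobson_radical UNIV"

lemma radical_left_ideal: "left_ideal_of UNIV radical"
  unfolding left_ideal_of_def jacobson_radical_def maximal_left_ideal_of_def by auto

text \<open>
  If \<open>1 - x\<close> had no left inverse, the left ideal it generates would lie in a maximal left ideal,
  which would contain \<open>x\<close> as well and hence 1.
\<close>
lemma one_minus_radical_left_invertible:
  assumes x: "x \<in> radical"
  shows "\<exists>u. u * (1 - x) = 1"
proof (rule ccontr)
  assume no: "\<nexists>u. u * (1 - x) = 1"
  have "left_ideal_of UNIV (range (\<lambda>u. u * (1 - x)))"
    unfolding left_ideal_of_def
  proof (intro conjI ballI)
    show "0 \<in> range (\<lambda>u. u * (1 - x))" by (rule image_eqI[of _ _ 0]) auto
    show "y - z \<in> range (\<lambda>u. u * (1 - x))"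
      if yz: "y \<in> range (\<lambda>u. u * (1 - x))" "z \<in> range (\<lambda>u. u * (1 - x))" for y z
    proof -
      obtain u v where "y = u * (1 - x)" "z = v * (1 - x)" using yz by auto
      then show ?thesis by (intro image_eqI[of _ _ "u - v"]) (simp_all add: left_diff_distrib)
    qed
    show "a * y \<in> range (\<lambda>u. u * (1 - x))" if y: "y \<in> range (\<lambda>u. u * (1 - x))" for a y
    proof -
      obtain u where "y = u * (1 - x)" using y by auto
      then show ?thesis by (intro image_eqI[of _ _ "a * u"]) (simp_all add: mult.assoc)
    qed
  qed simp
  moreover have "1 \<notin> range (\<lambda>u. u * (1 - x))" using no by (metis imageE)
  ultimately obtain M where M: "maximal_left_ideal_of UNIV M" "range (\<lambda>u. u * (1 - x)) \<subseteq> M"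
    using maximal_left_ideal_exists by blast
  have "x \<in> M" using x M by (auto simp: jacobson_radical_def)
  moreover have "1 * (1 - x) \<in> M" using M(2) by blast
  ultimately have "1 \<in> M"
    using M(1) subspace_add[OF left_ideal_subspace, of M "1 - x" x]
    by (simp add: maximal_left_ideal_of_def)
  then have "a * 1 \<in> M" for a
    using M(1) left_ideal_mult[of M 1 a] by (simp add: maximal_left_ideal_of_def)
  then show False using M(1) by (auto simp: maximal_left_ideal_of_def)
qed

text \<open>
  A left inverse \<open>u\<close> of \<open>1 - x\<close> equals \<open>1 + u * x\<close>, so it has a left inverse itself, which must be
  \<open>1 - x\<close>.
\<close>
lemma one_minus_radical_invertible:
  assumes x: "x \<in> radical"
  shows "\<exists>u. (1 - x) * u = 1"
proof -
  obtain u where u: "u * (1 - x) = 1" using one_minus_radical_left_invertible[OF x] by blast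
  have "- u * x \<in> radical" using radical_left_ideal x by (rule left_ideal_mult)
  then obtain v where "v * (1 - (- u * x)) = 1" using one_minus_radical_left_invertible by blast
  moreover have "1 - (- u * x) = u"
  proof -
    have "u - u * x = 1" using u by (simp only: right_diff_distrib mult_1_right)
    then have "u = 1 + u * x" by (simp only: diff_eq_eq)
    then show ?thesis by (simp only: minus_mult_left[symmetric] diff_minus_eq_add)
  qed
  ultimately have v: "v * u = 1" by simp
  have "v = v * (u * (1 - x))" by (simp add: u)
  also have "\<dots> = 1 - x" by (simp add: mult.assoc[symmetric] v)
  finally show ?thesis using v by blast
qed

text \<open>
  If \<open>x * r\<close> is not in a maximal left ideal \<open>M\<close>, then \<open>r = y * (x * r) + n\<close> for some \<open>y\<close> and some
  \<open>n \<in> M\<close>. As \<open>1 - y * x\<close> has a left inverse, \<open>r\<close> and then \<open>x * r\<close> are in \<open>M\<close> after all.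
\<close>
lemma radical_right_ideal:
  assumes x: "x \<in> radical"
  shows "x * r \<in> radical"
proof -
  have "x * r \<in> M" if M: "maximal_left_ideal_of UNIV M" for M
  proof (rule ccontr)
    assume notin: "x * r \<notin> M"
    have LM: "left_ideal_of UNIV M" using M by (simp add: maximal_left_ideal_of_def)
    note sub = left_ideal_subspace[OF LM]
    have mult: "a * y \<in> M" if "y \<in> M" for a y
      using LM that by (rule left_ideal_mult)
    define N where "N = {y * (x * r) + n | y n. n \<in> M}"
    have N_I: "y * (x * r) + n \<in> N" if "n \<in> M" for y n using that by (auto simp: N_def)
    have "left_ideal_of UNIV N"
      unfolding left_ideal_of_def
    proof (intro conjI ballI)
      show "0 \<in> N" using N_I[of 0 0] subspace_0[OF sub] by simp
      show "a - b \<in> N" if ab: "a \<in> N" "b \<in> N" for a b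
      proof -
        obtain y n y' n' where *: "a = y * (x * r) + n" "b = y' * (x * r) + n'" "n \<in> M" "n' \<in> M"
          using ab by (auto simp: N_def)
        have "a - b = (y - y') * (x * r) + (n - n')" by (simp add: * algebra_simps)
        then show ?thesis using N_I subspace_diff[OF sub *(3,4)] by metis
      qed
      show "a * b \<in> N" if b: "b \<in> N" for a b
      proof -
        obtain y n where *: "b = y * (x * r) + n" "n \<in> M" using b by (auto simp: N_def)
        have "a * b = (a * y) * (x * r) + a * n" by (simp add: * algebra_simps)
        then show ?thesis using N_I[OF mult[OF *(2)]] by metis
      qed
    qed simp
    moreover have "M \<subseteq> N"
      using N_I[of _ 0] by auto
    moreover have "x * r \<in> N" using N_I[of 0 1] subspace_0[OF sub] by simp
    ultimately have "N = UNIV"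
      using M notin by (auto simp: maximal_left_ideal_of_def)
    then obtain y n where r: "r = y * (x * r) + n" "n \<in> M" unfolding N_def by blast
    have "y * x \<in> radical" using radical_left_ideal x by (rule left_ideal_mult)
    then obtain u where u: "u * (1 - y * x) = 1" using one_minus_radical_left_invertible by blast
    have "(1 - y * x) * r = n" 
    proof -
      have "r - y * (x * r) = n" by (subst (1) r(1)) simp
      then show ?thesis by (simp add: left_diff_distrib mult.assoc)
    qed
    then have "u * n = r" using u by (metis mult.assoc mult_1)
    then have "r \<in> M" using mult[OF r(2), of u] by simp
    then have "x * r \<in> M" by (rule mult)
    then show False using notin by contradiction
  qed
  then show ?thesis by (simp add: jacobson_radical_def)
qed

text \<open>
  The right ideal generated by \<open>z\<^sub>1 \<dots> z\<^sub>n\<close> shrinks strictly when a further factor \<open>z\<close> from the radical is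
  appended, unless it is already zero: \<open>p = p * z * r\<close> means \<open>p * (1 - z * r) = 0\<close>, where \<open>1 - z * r\<close> is
  invertible. This can happen at most as often as the dimension allows.
\<close>
lemma radical_nilpotent:
  assumes "set zs \<subseteq> radical" and "dimension < length zs"
  shows "prod_list zs = 0"
proof -
  have "prod_list zs = 0 \<or> dim (range ((*) (prod_list zs))) + length zs \<le> dimension"
    using assms(1)
  proof (induction zs rule: rev_induct)
    case Nil
    then show ?case by (simp add: dim_subset_UNIV del: dim_UNIV)
  next
    case (snoc z zs)
    define p where "p = prod_list zs"
    have pz: "prod_list (zs @ [z]) = p * z" by (simp add: p_def)
    show ?case
    proof (cases "p * z = 0")
      case False
      then have p0: "p \<noteq> 0" by auto
      have sub: "subspace (range ((*) a))" for a
      proof -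
        interpret m: Vector_Spaces.linear scale scale "(*) a" by (rule linear_mult_left)
        show ?thesis by (rule m.subspace_image[OF subspace_UNIV])
      qed
      have le: "range ((*) (p * z)) \<subseteq> range ((*) p)" by (auto simp: mult.assoc)
      have "range ((*) (p * z)) \<noteq> range ((*) p)"
      proof
        assume "range ((*) (p * z)) = range ((*) p)"
        moreover have "p * 1 \<in> range ((*) p)" by (rule rangeI)
        ultimately obtain r where r: "p = p * z * r" by (metis imageE mult_1_right)
        then have kill: "p * (1 - z * r) = 0" by (simp add: right_diff_distrib mult.assoc)
        obtain u where "(1 - z * r) * u = 1"
          using one_minus_radical_invertible radical_right_ideal snoc.prems by force
        then have "p = p * (1 - z * r) * u" by (simp add: mult.assoc)
        then show False using kill p0 by simp
      qed
      then have "dim (range ((*) (p * z))) < dim (range ((*) p))"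
        using le sub by (intro dim_psubset) (simp add: span_eq_iff[THEN iffD2, OF sub] psubset_eq)
      then show ?thesis
        using snoc p0 False unfolding pz p_def[symmetric] by auto
    qed (simp add: pz p_def)
  qed
  then show ?thesis using assms(2) by linarith
qed

end

locale alg_closed_algebra = finite_dimensional_algebra scale Basis
  for scale :: "'k::alg_closed_field \<Rightarrow> 'r::ring_1 \<Rightarrow> 'r" (infixr "*s" 75) and Basis :: "'r set"
begin

text \<open>
  Evaluating polynomials at \<open>x\<close> and applying the result to the vector \<open>a\<close> cannot be injective, since
  the dimension is finite. A nonzero polynomial \<open>p\<close> of least degree that annihilates \<open>a\<close> has a root
  \<open>c\<close>, and \<open>p\<close> divided by its factor for \<open>c\<close> maps \<open>a\<close> to an eigenvector.
\<close>
lemma eigenvector_exists: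
  assumes W: "subspace W" and inv: "\<And>w. w \<in> W \<Longrightarrow> x * w \<in> W" and a: "a \<in> W" "a \<noteq> 0"
  shows "\<exists>c. \<exists>y\<in>W. y \<noteq> 0 \<and> x * y = c *s y"
proof -
  \<comment> \<open>ev p is the vector p(x) a, computed by Horner's scheme\<close>
  define ev where "ev p = fold_coeffs (\<lambda>c r. c *s a + x * r) p 0" for p
  have ev_0 [simp]: "ev 0 = 0" by (simp add: ev_def)
  have ev_pCons [simp]: "ev (pCons c p) = c *s a + x * ev p" for c p
    by (cases "p = 0"; cases "c = 0") (simp_all add: ev_def)
  have ev_smult: "ev (smult c p) = c *s ev p" for c p
    by (induction p) (simp_all add: scale_right_distrib scale_mult_right)
  have ev_add: "ev (p + q) = ev p + ev q" for p q
    by (induction p q rule: poly_induct2) (simp_all add: algebra_simps scale_left_distrib)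
  have ev_monom: "ev (monom c n) = c *s (x ^ n * a)" for c n
    by (induction n) (simp_all add: monom_0 monom_Suc scale_mult_right mult.assoc)
  have ev_sum: "ev (\<Sum>i\<in>I. f i) = (\<Sum>i\<in>I. ev (f i))" for f and I :: "nat set"
    by (induction I rule: infinite_finite_induct) (simp_all add: ev_add)
  have ev_W: "ev p \<in> W" for p
    by (induction p)
       (auto intro!: subspace_add[OF W] subspace_scale[OF W] inv a subspace_0[OF W])
  have "\<exists>p. p \<noteq> 0 \<and> ev p = 0"
  proof (rule ccontr)
    assume "\<nexists>p. p \<noteq> 0 \<and> ev p = 0"
    then have inj0: "p = 0" if "ev p = 0" for p using that by blast
    define f where "f n = x ^ n * a" for n
    have inj: "inj f"
    proof (rule injI)
      fix i j
      assume "f i = f j"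
      then have "ev (monom 1 i + smult (-1) (monom 1 j)) = 0"
        unfolding ev_add ev_smult ev_monom f_def by simp
      then have "monom 1 i + smult (-1) (monom 1 j) = (0 :: 'k poly)" by (rule inj0)
      then have "monom 1 i = (monom 1 j :: 'k poly)" by simp
      then show "i = j" by (simp add: monom_eq_iff')
    qed
    have "independent (range f)"
      unfolding independent_explicit_finite_subsets
    proof (intro allI impI ballI)
      fix S u v
      assume S: "S \<subseteq> range f" "finite S" "(\<Sum>v\<in>S. u v *s v) = 0" "v \<in> S"
      obtain E where E: "finite E" "S = f ` E"
        using finite_subset_image[OF S(2,1)] by blast
      have "ev (\<Sum>i\<in>E. monom (u (f i)) i) = (\<Sum>i\<in>E. u (f i) *s f i)"
        by (simp add: ev_sum ev_monom f_def)
      also have "\<dots> = 0" using S(3) E inj by (simp add: sum.reindex inj_on_subset)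
      finally have z: "(\<Sum>i\<in>E. monom (u (f i)) i) = 0" by (rule inj0)
      obtain i where i: "i \<in> E" "v = f i" using S(4) E(2) by blast
      have "u (f i) = coeff (\<Sum>i\<in>E. monom (u (f i)) i) i"
        using i E(1) by (simp add: coeff_sum)
      then show "u v = 0" using z i by simp
    qed
    then have "finite (range f)" by (rule finiteI_independent)
    then show False using inj finite_imageD by blast
  qed
  then obtain p where p: "p \<noteq> 0" "ev p = 0"
    and minimal: "\<And>q. q \<noteq> 0 \<Longrightarrow> ev q = 0 \<Longrightarrow> degree p \<le> degree q"
    using ex_has_least_nat[of "\<lambda>p. p \<noteq> 0 \<and> ev p = 0" _ degree] by metis
  have "degree p > 0"
  proof (rule ccontr)
    assume "\<not> degree p > 0"
    then obtain c where "p = [:c:]" by (metis degree_eq_zeroE neq0_conv)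
    then show False using p a by simp
  qed
  then obtain c where "poly p c = 0" using alg_closed_imp_poly_has_root by blast
  then obtain q where q: "p = [:-c, 1:] * q" by (metis dvdE poly_eq_0_iff_dvd)
  have "q \<noteq> 0" using p q by auto
  then have "degree p = Suc (degree q)" unfolding q by (subst degree_mult_eq) auto
  then have "ev q \<noteq> 0" using minimal[of q] \<open>q \<noteq> 0\<close> by auto
  moreover have "x * ev q = c *s ev q"
  proof -
    have "p = pCons 0 q + smult (-c) q" by (simp add: q)
    then have "ev p = x * ev q - c *s ev q" by (simp only: ev_add ev_smult ev_pCons) simp
    then show ?thesis using p by simp
  qed
  ultimately show ?thesis using ev_W by blast
qed

end

section \<open>The group of word characters\<close>

text \<open>
  The scalars by which a word \<open>w\<close> in quantum commuting elements \<open>u\<^sub>i\<close> commutes with the single elements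
  \<open>u\<^sub>j\<close>, for \<open>j \<in> I\<close>.
\<close>
definition word_char :: "'i set \<Rightarrow> ('i \<Rightarrow> 'i \<Rightarrow> 'k::field) \<Rightarrow> 'i list \<Rightarrow> 'i \<Rightarrow> 'k" where
  "word_char I \<theta> w = (\<lambda>j. if j \<in> I then \<Prod>i\<leftarrow>w. \<theta> i j else 1)"

definition word_chars :: "'i set \<Rightarrow> ('i \<Rightarrow> 'i \<Rightarrow> 'k::field) \<Rightarrow> ('i \<Rightarrow> 'k) set" where
  "word_chars I \<theta> = word_char I \<theta> ` lists I"

lemma word_char_Nil: "word_char I \<theta> [] = (\<lambda>_. 1)"
  unfolding word_char_def by (rule ext) simp

lemma word_char_append: "word_char I \<theta> (v @ w) = (\<lambda>j. word_char I \<theta> v j * word_char I \<theta> w j)"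
  by (auto simp: word_char_def fun_eq_iff)

lemma word_char_nonzero:
  assumes "\<And>i j. i \<in> I \<Longrightarrow> j \<in> I \<Longrightarrow> \<theta> i j \<noteq> 0" and "w \<in> lists I"
  shows "word_char I \<theta> w j \<noteq> 0"
  using assms by (auto simp: word_char_def prod_list_zero_iff)

lemma word_chars_nonzero:
  assumes nz: "\<And>i j. i \<in> I \<Longrightarrow> j \<in> I \<Longrightarrow> \<theta> i j \<noteq> 0" and f: "f \<in> word_chars I \<theta>"
  shows "f j \<noteq> 0"
proof -
  obtain w where "w \<in> lists I" "f = word_char I \<theta> w" using f by (auto simp: word_chars_def)
  then show ?thesis using word_char_nonzero[OF nz] by simp
qed

lemma word_chars_group:
  assumes "finite (word_chars I \<theta>)" and nz: "\<And>i j. i \<in> I \<Longrightarrow> j \<in> I \<Longrightarrow> \<theta> i j \<noteq> 0"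
  shows "comm_group (char_group (word_chars I \<theta>))"
proof (rule char_group_comm_group)
  have "word_char I \<theta> [] \<in> word_chars I \<theta>" unfolding word_chars_def by (intro imageI) simp
  then show "(\<lambda>_. 1) \<in> word_chars I \<theta>" by (simp add: word_char_Nil)
  show "(\<lambda>j. f j * g j) \<in> word_chars I \<theta>" if fg: "f \<in> word_chars I \<theta>" "g \<in> word_chars I \<theta>" for f g
  proof -
    obtain v w where "f = word_char I \<theta> v" "g = word_char I \<theta> w" "v \<in> lists I" "w \<in> lists I"
      using fg by (auto simp: word_chars_def)
    then show ?thesis
      unfolding word_chars_def
      by (intro image_eqI[of _ _ "v @ w"]) (simp_all add: word_char_append)
  qed
  show "f j \<noteq> 0" if "f \<in> word_chars I \<theta>" for f j
    by (rule word_chars_nonzero[OF nz that])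
qed fact

text \<open>
  Restriction to \<open>I\<close> is a homomorphism on the word characters of \<open>S\<close>. Its image \<open>Y\<close> contains the word
  characters of \<open>I\<close> as a subgroup, because words over \<open>I\<close> are also words over \<open>S\<close>. Both steps
  divide orders.
\<close>
lemma card_word_chars_dvd:
  fixes \<theta> :: "'i \<Rightarrow> 'i \<Rightarrow> 'k::field"
  assumes fin: "finite (word_chars S \<theta>)" and nz: "\<And>i j. i \<in> S \<Longrightarrow> j \<in> S \<Longrightarrow> \<theta> i j \<noteq> 0"
    and IS: "I \<subseteq> S"
  shows "card (word_chars I \<theta>) dvd card (word_chars S \<theta>)"
proof -
  define res where "res f = (\<lambda>j. if j \<in> I then f j else 1)" for f :: "'i \<Rightarrow> 'k"
  define Y where "Y = res ` word_chars S \<theta>"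
  interpret S: comm_group "char_group (word_chars S \<theta>)"
    by (rule word_chars_group[OF fin nz])
  have res_mult: "res (\<lambda>j. f j * g j) = (\<lambda>j. res f j * res g j)" for f g
    by (auto simp: res_def fun_eq_iff)
  have sub: "word_chars I \<theta> \<subseteq> Y"
  proof
    fix f
    assume "f \<in> word_chars I \<theta>"
    then obtain w where w: "w \<in> lists I" "f = word_char I \<theta> w" by (auto simp: word_chars_def)
    have "f = res (word_char S \<theta> w)"
      using w IS by (auto simp: res_def word_char_def fun_eq_iff)
    moreover have "w \<in> lists S" using w(1) IS by auto
    ultimately show "f \<in> Y" unfolding Y_def word_chars_def by blast
  qed
  have finY: "finite Y" by (simp add: Y_def fin)
  interpret Y: comm_group "char_group Y"
  proof (rule char_group_comm_group)
    have "res (\<lambda>_. 1) = (\<lambda>_. 1)" by (simp add: res_def)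
    then show "(\<lambda>_. 1) \<in> Y"
      using S.one_closed unfolding Y_def char_group_def
      by (metis imageI monoid.select_convs(2) partial_object.select_convs(1))
    show "(\<lambda>j. f j * g j) \<in> Y" if fg: "f \<in> Y" "g \<in> Y" for f g
    proof -
      obtain f' g' where *: "f = res f'" "g = res g'" "f' \<in> word_chars S \<theta>" "g' \<in> word_chars S \<theta>"
        using fg by (auto simp: Y_def)
      have "(\<lambda>j. f' j * g' j) \<in> word_chars S \<theta>"
        using S.m_closed[of f' g'] * by (simp add: char_group_def)
      then show ?thesis
        unfolding Y_def *(1,2) res_mult[symmetric] by (rule imageI)
    qed
    show "f j \<noteq> 0" if "f \<in> Y" for f j
      using that word_chars_nonzero[of S \<theta>, OF nz] by (auto simp: Y_def res_def split: if_splits)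
  qed (rule finY)
  interpret res: group_hom "char_group (word_chars S \<theta>)" "char_group Y" res
    using S.is_group Y.is_group
    by (intro group_hom.intro group_hom_axioms.intro homI)
       (simp_all add: char_group_def Y_def res_mult)
  interpret I: comm_group "char_group (word_chars I \<theta>)"
    using finite_subset[OF sub finY] nz IS by (intro word_chars_group) auto
  have "subgroup (word_chars I \<theta>) (char_group Y)"
  proof (rule Y.subgroupI)
    show "word_chars I \<theta> \<subseteq> carrier (char_group Y)" using sub by (simp add: char_group_def)
    show "word_chars I \<theta> \<noteq> {}" by (auto simp: word_chars_def)
    show "f \<otimes>\<^bsub>char_group Y\<^esub> g \<in> word_chars I \<theta>" if "f \<in> word_chars I \<theta>" "g \<in> word_chars I \<theta>" for f g
      using I.m_closed[of f g] that by (simp add: char_group_def)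
    show "inv\<^bsub>char_group Y\<^esub> f \<in> word_chars I \<theta>" if f: "f \<in> word_chars I \<theta>" for f
    proof -
      define g where "g = inv\<^bsub>char_group (word_chars I \<theta>)\<^esub> f"
      have g: "g \<in> word_chars I \<theta>"
        using I.inv_closed[of f] f by (simp add: char_group_def g_def)
      have "g \<otimes>\<^bsub>char_group Y\<^esub> f = \<one>\<^bsub>char_group Y\<^esub>"
        using I.l_inv[of f] f by (simp add: char_group_def g_def)
      then have "inv\<^bsub>char_group Y\<^esub> f = g"
        using Y.inv_equality[of g f] f g sub by (auto simp: char_group_def)
      then show ?thesis using g by simp
    qed
  qed
  then have "card (word_chars I \<theta>) dvd card Y"
    using Y.lagrange by (metis dvd_triv_right char_group_def order_def partial_object.select_convs(1))
  moreover have "card Y dvd card (word_chars S \<theta>)"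
    using res.order_eq_image_times_kernel fin
    by (simp add: order_def char_group_def Y_def)
  ultimately show ?thesis by (rule dvd_trans)
qed

text \<open>
  The bicharacter sends the characters of two words \<open>v\<close> and \<open>w\<close> to the product of all \<open>\<theta> i j\<close> with
  \<open>i\<close> in \<open>v\<close> and \<open>j\<close> in \<open>w\<close>. It depends on \<open>v\<close> only through its character, and by skew symmetry the same
  holds for \<open>w\<close>. Pairing with the one-letter words recovers all values of a character, whence it is
  nondegenerate.
\<close>
lemma card_word_chars_square:
  fixes \<theta> :: "'i \<Rightarrow> 'i \<Rightarrow> 'k::field"
  assumes fin: "finite (word_chars I \<theta>)"
    and skew: "\<And>i j. i \<in> I \<Longrightarrow> j \<in> I \<Longrightarrow> \<theta> i j * \<theta> j i = 1"
    and alt: "\<And>i. i \<in> I \<Longrightarrow> \<theta> i i = 1"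
  shows "\<exists>n. card (word_chars I \<theta>) = n\<^sup>2"
proof -
  have nz: "\<theta> i j \<noteq> 0" if "i \<in> I" "j \<in> I" for i j
    using skew[OF that] by auto
  interpret comm_group "char_group (word_chars I \<theta>)"
    by (rule word_chars_group[OF fin nz])
  define word where "word f = (SOME w. w \<in> lists I \<and> f = word_char I \<theta> w)" for f
  have word: "word f \<in> lists I \<and> f = word_char I \<theta> (word f)" if f: "f \<in> word_chars I \<theta>" for f
    unfolding word_def
  proof (rule someI_ex)
    show "\<exists>w. w \<in> lists I \<and> f = word_char I \<theta> w" using f by (auto simp: word_chars_def)
  qed
  define \<beta> where "\<beta> f g = (\<Prod>j\<leftarrow>word g. f j)" for f g :: "'i \<Rightarrow> 'k"
  have cons: "word_char I \<theta> (i # u) = (\<lambda>j. word_char I \<theta> [i] j * word_char I \<theta> u j)" for i u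
    using word_char_append[of I \<theta> "[i]" u] by simp
  have prod_mult: "(\<Prod>j\<leftarrow>u. f j * g j) = (\<Prod>j\<leftarrow>u. f j) * (\<Prod>j\<leftarrow>u. g j)"
    for u :: "'i list" and f g :: "'i \<Rightarrow> 'k"
    by (induction u) (simp_all add: mult_ac)
  have single: "(\<Prod>j\<leftarrow>w. word_char I \<theta> [i] j) * word_char I \<theta> w i = 1"
    if i: "i \<in> I" and w: "w \<in> lists I" for i w
    using w
  proof (induction w)
    case Nil
    then show ?case by (simp add: word_char_Nil)
  next
    case (Cons j w)
    have "\<theta> i j * \<theta> j i = 1" using skew i Cons.hyps by simp
    then have 1: "word_char I \<theta> [i] j * word_char I \<theta> [j] i = 1"
      using i Cons.hyps by (simp add: word_char_def)
    have "(\<Prod>j\<leftarrow>j # w. word_char I \<theta> [i] j) * word_char I \<theta> (j # w) i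
        = (word_char I \<theta> [i] j * word_char I \<theta> [j] i)
          * ((\<Prod>j\<leftarrow>w. word_char I \<theta> [i] j) * word_char I \<theta> w i)"
      unfolding cons[of j w] by (simp add: mult_ac)
    then show ?case using Cons.IH 1 by simp
  qed
  have pair_skew: "(\<Prod>j\<leftarrow>w. word_char I \<theta> v j) * (\<Prod>i\<leftarrow>v. word_char I \<theta> w i) = 1"
    if v: "v \<in> lists I" and w: "w \<in> lists I" for v w
    using v
  proof (induction v)
    case Nil
    have "(\<Prod>j\<leftarrow>w. 1 :: 'k) = 1" by (induction w) simp_all
    then show ?case by (simp add: word_char_Nil)
  next
    case (Cons i v)
    have "(\<Prod>j\<leftarrow>w. word_char I \<theta> (i # v) j) * (\<Prod>i\<leftarrow>i # v. word_char I \<theta> w i)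
        = ((\<Prod>j\<leftarrow>w. word_char I \<theta> [i] j) * word_char I \<theta> w i)
          * ((\<Prod>j\<leftarrow>w. word_char I \<theta> v j) * (\<Prod>i\<leftarrow>v. word_char I \<theta> w i))"
      unfolding cons[of i v] prod_mult by (simp add: mult_ac)
    then show ?case using Cons.IH single[OF Cons.hyps(1) w] by simp
  qed
  have pair_alt: "(\<Prod>j\<leftarrow>v. word_char I \<theta> v j) = 1" if v: "v \<in> lists I" for v
    using v
  proof (induction v)
    case Nil
    then show ?case by simp
  next
    case (Cons i v)
    have "(\<Prod>j\<leftarrow>i # v. word_char I \<theta> (i # v) j)
        = word_char I \<theta> [i] i * ((\<Prod>j\<leftarrow>v. word_char I \<theta> [i] j) * word_char I \<theta> v i)
          * (\<Prod>j\<leftarrow>v. word_char I \<theta> v j)"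
      unfolding cons[of i v] prod_mult by (simp add: mult_ac)
    moreover have "word_char I \<theta> [i] i = 1" using Cons.hyps alt by (simp add: word_char_def)
    ultimately show ?case using Cons.IH single[OF Cons.hyps] by simp
  qed
  have skew_\<beta>: "\<beta> f g * \<beta> g f = 1" if f: "f \<in> word_chars I \<theta>" and g: "g \<in> word_chars I \<theta>" for f g
    using pair_skew[of "word f" "word g"] word[OF f] word[OF g] by (simp add: \<beta>_def)
  have left: "\<beta> (\<lambda>j. f j * g j) h = \<beta> f h * \<beta> g h" for f g h
    unfolding \<beta>_def by (rule prod_mult)
  have right: "\<beta> h (\<lambda>j. f j * g j) = \<beta> h f * \<beta> h g"
    if f: "f \<in> word_chars I \<theta>" and g: "g \<in> word_chars I \<theta>" and h: "h \<in> word_chars I \<theta>" for f g h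
  proof -
    have fg: "(\<lambda>j. f j * g j) \<in> word_chars I \<theta>"
      using m_closed[of f g] f g by (simp add: char_group_def)
    have "\<beta> h (\<lambda>j. f j * g j) * (\<beta> f h * \<beta> g h) = 1"
      using skew_\<beta>[OF h fg] by (simp add: left)
    moreover have "(\<beta> h f * \<beta> h g) * (\<beta> f h * \<beta> g h) = 1"
      using skew_\<beta>[OF h f] skew_\<beta>[OF h g] by (metis mult.commute mult.left_commute mult_1)
    ultimately show ?thesis by (metis mult_right_cancel mult_zero_right zero_neq_one)
  qed
  have "\<exists>n. order (char_group (word_chars I \<theta>)) = n\<^sup>2"
  proof (rule alternating_bicharacter_square[where \<beta> = \<beta>])
    fix f
    assume "f \<in> carrier (char_group (word_chars I \<theta>))"
    then have f: "f \<in> word_chars I \<theta>" by (simp add: char_group_def)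
    show "\<beta> f f = 1" using pair_alt[of "word f"] word[OF f] by (simp add: \<beta>_def)
    assume "\<And>g. g \<in> carrier (char_group (word_chars I \<theta>)) \<Longrightarrow> \<beta> f g = 1"
    then have triv: "\<beta> f g = 1" if "g \<in> word_chars I \<theta>" for g
      using that by (simp add: char_group_def)
    have "f j = 1" for j
    proof (cases "j \<in> I")
      case False
      then show ?thesis using f by (auto simp: word_chars_def word_char_def)
    next
      case True
      define g where "g = word_char I \<theta> [j]"
      have g: "g \<in> word_chars I \<theta>"
        unfolding g_def word_chars_def using True by (intro imageI) simp
      have "f j * \<beta> g f = 1"
        using pair_skew[of "word f" "[j]"] word[OF f] True by (simp add: \<beta>_def g_def)
      moreover have "\<beta> g f = 1" using skew_\<beta>[OF f g] triv[OF g] by simp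
      ultimately show ?thesis by simp
    qed
    then show "f = \<one>\<^bsub>char_group (word_chars I \<theta>)\<^esub>" by (simp add: char_group_def fun_eq_iff)
  qed (use fin left right comm_group_axioms in \<open>simp_all add: char_group_def\<close>)
  then show ?thesis by (simp add: order_def char_group_def)
qed

section \<open>Simple algebras spanned by quantum commuting elements\<close>

context finite_dimensional_algebra
begin

lemma simple_subalgebraD:
  assumes "simple_subalgebra A"
  shows "subspace A" and "\<And>x y. x \<in> A \<Longrightarrow> y \<in> A \<Longrightarrow> x * y \<in> A"
    and "\<And>L. two_sided_ideal_of A L \<Longrightarrow> L = {0} \<or> L = A" and "A \<noteq> {0}"
  using assms by (auto simp: simple_subalgebra_def subalgebra_def)

text \<open>
  Commuting with a spanning set up to nonzero scalars gives \<open>u A = A u\<close>. This is a nonzero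
  two-sided ideal of the simple algebra \<open>A\<close>, so it contains the identity.
\<close>
lemma twisted_commuting_unit:
  assumes simple: "simple_subalgebra A" and X: "span X = A"
    and e: "e \<in> A" and identity: "\<forall>x\<in>A. e * x = x \<and> x * e = x"
    and u: "u \<in> A" "u \<noteq> 0"
    and twist: "\<And>x. x \<in> X \<Longrightarrow> \<exists>c. c \<noteq> 0 \<and> u * x = c *s (x * u)"
  shows "\<exists>v\<in>A. u * v = e \<and> v * u = e"
proof -
  note A = simple_subalgebraD[OF simple]
  have left_id: "e * x = x" and right_id: "x * e = x" if "x \<in> A" for x
    using identity that by auto
  have X_A: "x \<in> A" if "x \<in> X" for x using that span_base X by blast
  have right_to_left: "\<exists>y\<in>A. u * x = y * u" if "x \<in> A" for x
  proof -
    have "x \<in> span X" using that X by simp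
    then show ?thesis
    proof (induction rule: span_induct)
      case base
      show ?case
      proof (rule subspaceI, goal_cases)
        case 1
        show ?case using subspace_0[OF A(1)] by (auto intro!: bexI[of _ 0])
      next
        case (2 x y)
        then obtain x' y' where "x' \<in> A" "y' \<in> A" "u * x = x' * u" "u * y = y' * u" by auto
        then show ?case
          using subspace_add[OF A(1)] by (auto simp: algebra_simps intro!: bexI[of _ "x' + y'"])
      next
        case (3 c x)
        then obtain x' where "x' \<in> A" "u * x = x' * u" by auto
        then show ?case
          using subspace_scale[OF A(1)]
          by (auto simp: scale_mult_left scale_mult_right intro!: bexI[of _ "c *s x'"])
      qed
    next
      case (step x)
      then obtain c where "u * x = c *s (x * u)" using twist by blast
      then show ?case
        using subspace_scale[OF A(1) X_A[OF step]]
        by (intro bexI[of _ "c *s x"]) (simp_all add: scale_mult_left)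
    qed
  qed
  have left_to_right: "\<exists>y\<in>A. x * u = u * y" if "x \<in> A" for x
  proof -
    have "x \<in> span X" using that X by simp
    then show ?thesis
    proof (induction rule: span_induct)
      case base
      show ?case
      proof (rule subspaceI, goal_cases)
        case 1
        show ?case using subspace_0[OF A(1)] by (auto intro!: bexI[of _ 0])
      next
        case (2 x y)
        then obtain x' y' where "x' \<in> A" "y' \<in> A" "x * u = u * x'" "y * u = u * y'" by auto
        then show ?case
          using subspace_add[OF A(1)] by (auto simp: algebra_simps intro!: bexI[of _ "x' + y'"])
      next
        case (3 c x)
        then obtain x' where "x' \<in> A" "x * u = u * x'" by auto
        then show ?case
          using subspace_scale[OF A(1)]
          by (auto simp: scale_mult_left scale_mult_right intro!: bexI[of _ "c *s x'"])
      qed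
    next
      case (step x)
      then obtain c where "c \<noteq> 0" "u * x = c *s (x * u)" using twist by blast
      then show ?case
        using subspace_scale[OF A(1) X_A[OF step]]
        by (intro bexI[of _ "inverse c *s x"]) (simp_all add: scale_mult_right)
    qed
  qed
  have "two_sided_ideal_of A ((*) u ` A)"
    unfolding two_sided_ideal_of_def left_ideal_of_def
  proof (intro conjI ballI)
    show "(*) u ` A \<subseteq> A" using A(2) u(1) by blast
    show "0 \<in> (*) u ` A" using subspace_0[OF A(1)] by (intro image_eqI[of _ _ 0]) auto
    show "x - y \<in> (*) u ` A" if xy: "x \<in> (*) u ` A" "y \<in> (*) u ` A" for x y
    proof -
      obtain x' y' where "x = u * x'" "y = u * y'" "x' \<in> A" "y' \<in> A" using xy by auto
      then show ?thesis
        using subspace_diff[OF A(1)]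
        by (intro image_eqI[of _ _ "x' - y'"]) (simp_all add: right_diff_distrib)
    qed
    show "a * x \<in> (*) u ` A" if a: "a \<in> A" and x: "x \<in> (*) u ` A" for a x
    proof -
      obtain x' where x': "x = u * x'" "x' \<in> A" using x by auto
      obtain a' where a': "a' \<in> A" "a * u = u * a'" using left_to_right[OF a] by blast
      have "a * x = u * (a' * x')" by (metis a'(2) mult.assoc x'(1))
      then show ?thesis using A(2)[OF a'(1) x'(2)] by blast
    qed
    show "x * a \<in> (*) u ` A" if a: "a \<in> A" and x: "x \<in> (*) u ` A" for a x
    proof -
      obtain x' where x': "x = u * x'" "x' \<in> A" using x by auto
      then show ?thesis using A(2)[OF x'(2) a] by (simp add: mult.assoc)
    qed
  qed
  moreover have "u * e \<in> (*) u ` A" using e by (rule imageI)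
  then have "u \<in> (*) u ` A" using right_id[OF u(1)] by simp
  ultimately have "(*) u ` A = A" using A(3) u(2) by blast
  then obtain v where v: "v \<in> A" "u * v = e" using e by (metis imageE)
  obtain w where w: "w \<in> A" "u * v = w * u" using right_to_left[OF v(1)] by blast
  have "w = w * (u * v)" using v(2) right_id[OF w(1)] by simp
  also have "\<dots> = (w * u) * v" by (simp add: mult.assoc)
  also have "\<dots> = v" using w(2) v left_id by simp
  finally show ?thesis using v w by metis
qed

end

context alg_closed_algebra
begin

text \<open>
  A version of Schur's lemma. If \<open>v\<inverse> u\<close> has eigenvalue \<open>c\<close>, then \<open>u - c v\<close> is a left zero divisor. It
  commutes with \<open>X\<close> up to the same scalars as \<open>u\<close> and \<open>v\<close>, hence would be invertible if it were
  nonzero.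
\<close>
lemma equally_twisted_proportional:
  assumes simple: "simple_subalgebra A" and X: "span X = A"
    and u: "u \<in> A" and v: "v \<in> A" "v \<noteq> 0"
    and twist: "\<And>x. x \<in> X \<Longrightarrow> \<exists>c. c \<noteq> 0 \<and> u * x = c *s (x * u) \<and> v * x = c *s (x * v)"
  shows "\<exists>c. u = c *s v"
proof -
  note A = simple_subalgebraD[OF simple]
  obtain e where e: "e \<in> A" "\<forall>x\<in>A. e * x = x \<and> x * e = x"
    using simple by (auto simp: simple_subalgebra_def subalgebra_def)
  note unit = twisted_commuting_unit[OF simple X e]
  have left_id: "e * x = x" if "x \<in> A" for x using e(2) that by auto
  obtain v' where v': "v' \<in> A" "v * v' = e" "v' * v = e"
  proof -
    have "\<exists>v'\<in>A. v * v' = e \<and> v' * v = e" using twist by (intro unit[OF v]) blast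
    then show thesis using that by blast
  qed
  have "e \<noteq> 0"
    using v left_id[OF v(1)] by auto
  then obtain c y where y: "y \<in> A" "y \<noteq> 0" "(v' * u) * y = c *s y"
    using eigenvector_exists[OF A(1), of "v' * u" e] A(2) v'(1) u e(1) by metis
  have "u * y = v * ((v' * u) * y)"
    using v'(2) left_id[OF A(2)[OF u y(1)]] by (metis mult.assoc)
  also have "\<dots> = c *s (v * y)" by (simp add: y(3) scale_mult_right)
  finally have kill: "(u - c *s v) * y = 0" by (simp add: left_diff_distrib scale_mult_left)
  have "u - c *s v = 0"
  proof (rule ccontr)
    assume nz: "u - c *s v \<noteq> 0"
    have "\<exists>w\<in>A. (u - c *s v) * w = e \<and> w * (u - c *s v) = e"
    proof (rule unit[OF _ nz])
      show "u - c *s v \<in> A" using u v A(1) by (simp add: subspace_diff subspace_scale)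
      show "\<exists>d. d \<noteq> 0 \<and> (u - c *s v) * x = d *s (x * (u - c *s v))" if x: "x \<in> X" for x
      proof -
        obtain d where "d \<noteq> 0" "u * x = d *s (x * u)" "v * x = d *s (x * v)"
          using twist[OF x] by blast
        then show ?thesis
          by (intro exI[of _ d])
             (simp add: left_diff_distrib right_diff_distrib scale_mult_left scale_mult_right
               scale_right_diff_distrib mult.commute)
      qed
    qed
    then obtain w where "w \<in> A" "w * (u - c *s v) = e" by blast
    then have "y = w * ((u - c *s v) * y)" using left_id[OF y(1)] by (simp add: mult.assoc[symmetric])
    then show False using kill y(2) by simp
  qed
  then show ?thesis by auto
qed

end

text \<open>
  This is the structure that a regular quantum commutative decomposition induces on each simple
  quotient \<open>A\<close>: \<open>I\<close> is the set of components with a nonzero image, and \<open>u i\<close> spans the image of the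
  \<open>i\<close>-th one.
\<close>
locale quantum_simple_algebra = alg_closed_algebra scale Basis
  for scale :: "'k::alg_closed_field \<Rightarrow> 'r::ring_1 \<Rightarrow> 'r" (infixr "*s" 75) and Basis :: "'r set" +
  fixes A :: "'r set" and I :: "'i set" and u :: "'i \<Rightarrow> 'r" and \<theta> :: "'i \<Rightarrow> 'i \<Rightarrow> 'k"
  assumes simple: "simple_subalgebra A"
    and finite_I: "finite I"
    and u_nonzero: "\<And>i. i \<in> I \<Longrightarrow> u i \<noteq> 0"
    and span_u: "span (u ` I) = A"
    and theta_nz: "\<And>i j. i \<in> I \<Longrightarrow> j \<in> I \<Longrightarrow> \<theta> i j \<noteq> 0"
    and u_commute: "\<And>i j. i \<in> I \<Longrightarrow> j \<in> I \<Longrightarrow> u i * u j = \<theta> i j *s (u j * u i)"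
begin

lemmas A = simple_subalgebraD[OF simple]

definition e where "e = (SOME e. e \<in> A \<and> (\<forall>x\<in>A. e * x = x \<and> x * e = x))"

lemma e: "e \<in> A" "x \<in> A \<Longrightarrow> e * x = x" "x \<in> A \<Longrightarrow> x * e = x"
proof -
  have "\<exists>e. e \<in> A \<and> (\<forall>x\<in>A. e * x = x \<and> x * e = x)"
    using simple by (auto simp: simple_subalgebra_def subalgebra_def)
  from someI_ex[OF this] show "e \<in> A" "x \<in> A \<Longrightarrow> e * x = x" "x \<in> A \<Longrightarrow> x * e = x"
    by (auto simp: e_def)
qed

lemma e_nonzero: "e \<noteq> 0"
proof
  assume "e = 0"
  then have "x = 0" if "x \<in> A" for x using e(2)[OF that] by simp
  then show False using A(4) subspace_0[OF A(1)] by auto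
qed

lemma u_in_A: "i \<in> I \<Longrightarrow> u i \<in> A"
  using span_base span_u by blast

lemma u_inverse:
  assumes i: "i \<in> I"
  shows "\<exists>v\<in>A. u i * v = e \<and> v * u i = e"
proof (rule twisted_commuting_unit[OF simple span_u e(1) _ u_in_A[OF i] u_nonzero[OF i]])
  show "\<forall>x\<in>A. e * x = x \<and> x * e = x" using e by blast
  show "\<exists>c. c \<noteq> 0 \<and> u i * x = c *s (x * u i)" if "x \<in> u ` I" for x
    using that theta_nz[OF i] u_commute[OF i] by blast
qed

lemma u_cancel:
  assumes "i \<in> I" "x \<in> A" "x \<noteq> 0"
  shows "u i * x \<noteq> 0"
proof
  assume z: "u i * x = 0"
  obtain v where "v * u i = e" using u_inverse[OF assms(1)] by blast
  then have "x = v * (u i * x)" using e(2)[OF assms(2)] by (simp add: mult.assoc[symmetric])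
  then show False using z assms(3) by simp
qed

lemma theta_alternating: "i \<in> I \<Longrightarrow> \<theta> i i = 1"
proof -
  assume i: "i \<in> I"
  have "1 *s (u i * u i) = \<theta> i i *s (u i * u i)" unfolding scale_one by (rule u_commute[OF i i])
  then have "1 = \<theta> i i"
    using scale_cancel_right u_cancel[OF i u_in_A[OF i] u_nonzero[OF i]] by metis
  then show ?thesis by simp
qed

lemma theta_skew: "i \<in> I \<Longrightarrow> j \<in> I \<Longrightarrow> \<theta> i j * \<theta> j i = 1"
proof -
  assume i: "i \<in> I" and j: "j \<in> I"
  have "u i * u j = \<theta> i j *s (\<theta> j i *s (u i * u j))"
    using u_commute[OF i j] u_commute[OF j i] by metis
  then have "1 *s (u i * u j) = (\<theta> i j * \<theta> j i) *s (u i * u j)"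
    unfolding scale_one scale_scale .
  then have "1 = \<theta> i j * \<theta> j i"
    using scale_cancel_right u_cancel[OF i u_in_A[OF j] u_nonzero[OF j]] by metis
  then show ?thesis by simp
qed

text \<open>
  The factor \<open>e\<close> makes the empty word the identity of \<open>A\<close>, which may differ from the identity
  of the ambient algebra.
\<close>
definition word :: "'i list \<Rightarrow> 'r" where
  "word w = prod_list (map u w) * e"

lemma word_Nil: "word [] = e" and word_Cons: "word (i # w) = u i * word w"
  by (simp_all add: word_def mult.assoc)

lemma word_in_A: "w \<in> lists I \<Longrightarrow> word w \<in> A"
  by (induction w) (auto simp: word_Nil word_Cons intro!: A(2) e(1) u_in_A)

lemma word_nonzero: "w \<in> lists I \<Longrightarrow> word w \<noteq> 0"
proof (induction w)
  case Nil
  then show ?case by (simp add: word_Nil e_nonzero)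
next
  case (Cons i w)
  then show ?case using u_cancel[of i "word w"] word_in_A[of w] by (auto simp: word_Cons)
qed

lemma word_commute:
  assumes j: "j \<in> I" and "w \<in> lists I"
  shows "word w * u j = word_char I \<theta> w j *s (u j * word w)"
  using assms(2)
proof (induction w)
  case Nil
  then show ?case using e u_in_A[OF j] by (simp add: word_Nil word_char_Nil)
next
  case (Cons i w)
  have "word (i # w) * u j = u i * (word w * u j)" by (simp add: word_Cons mult.assoc)
  also have "\<dots> = word_char I \<theta> w j *s ((u i * u j) * word w)"
    by (simp add: Cons.IH scale_mult_right mult.assoc)
  also have "\<dots> = word_char I \<theta> w j *s (\<theta> i j *s (u j * word (i # w)))"
    by (subst u_commute[OF Cons.hyps(1) j]) (simp add: scale_mult_left word_Cons mult.assoc)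
  also have "\<dots> = word_char I \<theta> (i # w) j *s (u j * word (i # w))"
    using j by (simp add: word_char_def mult.commute)
  finally show ?case .
qed

definition word_of :: "('i \<Rightarrow> 'k) \<Rightarrow> 'i list" where
  "word_of f = (SOME w. w \<in> lists I \<and> f = word_char I \<theta> w)"

lemma word_of:
  assumes "f \<in> word_chars I \<theta>"
  shows "word_of f \<in> lists I" and "word_char I \<theta> (word_of f) = f"
proof -
  have "\<exists>w. w \<in> lists I \<and> f = word_char I \<theta> w" using assms by (auto simp: word_chars_def)
  from someI_ex[OF this] show "word_of f \<in> lists I" "word_char I \<theta> (word_of f) = f"
    by (auto simp: word_of_def)
qed

text \<open>
  The words are joint eigenvectors of the conjugations \<open>x \<mapsto> u\<^sub>j\<inverse> x u\<^sub>j\<close>, and their eigenvalues are the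
  values of their characters.
\<close>
lemma word_independent:
  "inj_on (\<lambda>f. word (word_of f)) (word_chars I \<theta>)"
  "independent ((\<lambda>f. word (word_of f)) ` word_chars I \<theta>)"
proof -
  have "\<forall>i\<in>I. \<exists>v. v * u i = e" using u_inverse by blast
  then obtain v where v: "\<And>i. i \<in> I \<Longrightarrow> v i * u i = e" by metis
  have lin: "Vector_Spaces.linear scale scale (\<lambda>x. v j * (x * u j))" for j
    by unfold_locales (simp_all add: algebra_simps scale_mult_left scale_mult_right)
  have eig: "v j * (word (word_of f) * u j) = f j *s word (word_of f)"
    if f: "f \<in> word_chars I \<theta>" and j: "j \<in> I" for f j
  proof -
    have "v j * (word (word_of f) * u j) = f j *s ((v j * u j) * word (word_of f))"
      using word_commute[OF j word_of(1)[OF f]] word_of(2)[OF f]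
      by (simp add: scale_mult_right mult.assoc)
    then show ?thesis using v[OF j] e(2) word_in_A[OF word_of(1)[OF f]] by simp
  qed
  have sep: "\<exists>j\<in>I. f j \<noteq> g j"
    if f: "f \<in> word_chars I \<theta>" and g: "g \<in> word_chars I \<theta>" and ne: "f \<noteq> g" for f g
  proof -
    obtain j where "f j \<noteq> g j" using ne by blast
    moreover have "f j = 1" "g j = 1" if "j \<notin> I"
      using f g that by (auto simp: word_chars_def word_char_def)
    ultimately show ?thesis by (cases "j \<in> I") auto
  qed
  note ind = joint_eigenvectors_independent[of I "\<lambda>j x. v j * (x * u j)" "word_chars I \<theta>"
      "\<lambda>f. word (word_of f)" "\<lambda>f. f", OF lin word_nonzero[OF word_of(1)] eig sep]
  show "inj_on (\<lambda>f. word (word_of f)) (word_chars I \<theta>)" by (rule ind(1))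
  show "independent ((\<lambda>f. word (word_of f)) ` word_chars I \<theta>)" by (rule ind(2))
qed

lemma finite_word_chars: "finite (word_chars I \<theta>)"
  using finiteI_independent[OF word_independent(2)] word_independent(1) finite_imageD by blast

text \<open>
  One word for each character gives a basis of \<open>A\<close>. It spans because each \<open>u j\<close> is proportional to
  the chosen word with the character of \<open>[j]\<close>.
\<close>
theorem dim_eq_card_word_chars: "dim A = card (word_chars I \<theta>)"
proof -
  let ?W = "(\<lambda>f. word (word_of f)) ` word_chars I \<theta>"
  have "u j \<in> span ?W" if j: "j \<in> I" for j
  proof -
    define f where "f = word_char I \<theta> [j]"
    have jI: "[j] \<in> lists I" using j by simp
    then have f: "f \<in> word_chars I \<theta>" unfolding f_def word_chars_def by (rule imageI)
    have "\<exists>c. u j = c *s word (word_of f)"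
    proof (rule equally_twisted_proportional[OF simple span_u u_in_A[OF j]])
      show "word (word_of f) \<in> A" "word (word_of f) \<noteq> 0"
        using word_in_A word_nonzero word_of(1)[OF f] by auto
      fix x
      assume "x \<in> u ` I"
      then obtain i where i: "i \<in> I" "x = u i" by blast
      have "f i = \<theta> j i" using i(1) by (simp add: f_def word_char_def)
      then show "\<exists>c. c \<noteq> 0 \<and> u j * x = c *s (x * u j)
          \<and> word (word_of f) * x = c *s (x * word (word_of f))"
        using word_commute[OF i(1) word_of(1)[OF f]] word_of(2)[OF f] u_commute[OF j i(1)]
          theta_nz[OF j i(1)] i(2) by auto
    qed
    then obtain c where "u j = c *s word (word_of f)" by blast
    then show ?thesis using f by (auto intro: span_scale span_base)
  qed
  then have "u ` I \<subseteq> span ?W" by blast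
  then have "A \<subseteq> span ?W" unfolding span_u[symmetric] by (intro span_minimal subspace_span)
  moreover have "?W \<subseteq> A" using word_in_A word_of(1) by auto
  ultimately have "dim A = card ?W" using word_independent(2) by (intro dim_unique) auto
  then show ?thesis using word_independent(1) by (simp add: card_image)
qed

lemma dim_le_card_I: "dim A \<le> card I"
proof -
  have "dim A \<le> card (u ` I)" using span_u finite_I by (intro dim_le_card) auto
  also have "\<dots> \<le> card I" using finite_I by (rule card_image_le)
  finally show ?thesis .
qed

corollary dim_square: "\<exists>n. dim A = n\<^sup>2"
  using card_word_chars_square[OF finite_word_chars theta_skew theta_alternating]
  by (simp add: dim_eq_card_word_chars)

end

section \<open>The simple summands of a regular quantum commutative algebra\<close>

context alg_closed_algebra
begin

text \<open>
  Elements of one component \<open>Rs i\<close> commute with homogeneous elements up to the same scalars \<open>\<theta> i j\<close>, so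
  their images in \<open>A\<close> are multiples of any nonzero one among them.
\<close>
lemma simple_quotient_quantum_simple_algebra:
  assumes rqca: "regular_quantum_commutative_algebra scale m Rs \<theta>"
    and simple: "simple_subalgebra A"
    and linear: "Vector_Spaces.linear scale scale \<phi>"
    and mult: "\<And>x y. \<phi> (x * y) = \<phi> x * \<phi> y"
    and range: "range \<phi> = A"
  shows "\<exists>u. quantum_simple_algebra scale Basis A {i\<in>{1..m}. \<exists>a\<in>Rs i. \<phi> a \<noteq> 0} u \<theta>"
proof -
  interpret R: regular_quantum_commutative_algebra scale m Rs \<theta> by (rule rqca)
  interpret \<phi>: Vector_Spaces.linear scale scale \<phi> by (rule linear)
  let ?I = "{i\<in>{1..m}. \<exists>a\<in>Rs i. \<phi> a \<noteq> 0}"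
  define X where "X = \<phi> ` (\<Union>i\<in>{1..m}. Rs i)"
  have "x \<in> span (\<Union>i\<in>{1..m}. Rs i)" for x
  proof -
    have "x \<in> (\<lambda>f. \<Sum>i\<in>{1..m}. f i) ` (\<Pi>\<^sub>E i\<in>{1..m}. Rs i)"
      using R.direct_sum_Rs by (simp add: internal_direct_sum_def bij_betw_def)
    then obtain f where "f \<in> (\<Pi>\<^sub>E i\<in>{1..m}. Rs i)" "x = (\<Sum>i\<in>{1..m}. f i)" by blast
    moreover have "(\<Sum>i\<in>{1..m}. f i) \<in> span (\<Union>i\<in>{1..m}. Rs i)"
      using calculation(1) by (intro span_sum span_base) blast
    ultimately show ?thesis by simp
  qed
  then have "span (\<Union>i\<in>{1..m}. Rs i) = UNIV" by blast
  then have span_X: "span X = A"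
    unfolding X_def \<phi>.span_image range[symmetric] by simp
  have commute: "\<phi> a * \<phi> b = \<theta> i j *s (\<phi> b * \<phi> a)"
    if "i \<in> {1..m}" "j \<in> {1..m}" "a \<in> Rs i" "b \<in> Rs j" for i j a b
  proof -
    have "\<phi> (a * b) = \<phi> (\<theta> i j *s (b * a))"
      by (rule arg_cong[OF R.quantum_commutative[OF that]])
    then show ?thesis by (simp only: mult \<phi>.scale)
  qed
  define u where "u i = \<phi> (SOME a. a \<in> Rs i \<and> \<phi> a \<noteq> 0)" for i
  have u: "\<exists>a\<in>Rs i. u i = \<phi> a \<and> u i \<noteq> 0" if "i \<in> ?I" for i
  proof -
    have "\<exists>a. a \<in> Rs i \<and> \<phi> a \<noteq> 0" using that by blast
    from someI_ex[OF this] show ?thesis unfolding u_def by blast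
  qed
  have line: "\<exists>c. \<phi> b = c *s u i" if i: "i \<in> ?I" and b: "b \<in> Rs i" for i b
  proof (rule equally_twisted_proportional[OF simple span_X])
    obtain a where a: "a \<in> Rs i" "u i = \<phi> a" "u i \<noteq> 0" using u[OF i] by blast
    show "\<phi> b \<in> A" "u i \<in> A" "u i \<noteq> 0" using range a by auto
    show "\<exists>c. c \<noteq> 0 \<and> \<phi> b * x = c *s (x * \<phi> b) \<and> u i * x = c *s (x * u i)" if x: "x \<in> X" for x
    proof -
      obtain j d where j: "j \<in> {1..m}" "d \<in> Rs j" "x = \<phi> d" using x by (auto simp: X_def)
      then show ?thesis
        using commute[of i j b d] commute[of i j a d] R.theta_nonzero[of i j] i a b
        by (intro exI[of _ "\<theta> i j"]) simp
    qed
  qed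
  have "quantum_simple_algebra scale Basis A ?I u \<theta>"
  proof unfold_locales
    show "simple_subalgebra A" by (rule simple)
    show "finite ?I" by simp
    show "u i \<noteq> 0" if "i \<in> ?I" for i using u[OF that] by blast
    show "\<theta> i j \<noteq> 0" if "i \<in> ?I" "j \<in> ?I" for i j using that R.theta_nonzero by simp
    show "u i * u j = \<theta> i j *s (u j * u i)" if i: "i \<in> ?I" and j: "j \<in> ?I" for i j
    proof -
      obtain a b where ab: "a \<in> Rs i" "u i = \<phi> a" "b \<in> Rs j" "u j = \<phi> b"
        using u[OF i] u[OF j] by blast
      have "i \<in> {1..m}" "j \<in> {1..m}" using i j by auto
      then show ?thesis unfolding ab(2,4) using ab(1,3) by (rule commute)
    qed
    show "span (u ` ?I) = A"
    proof
      have "u ` ?I \<subseteq> A" using u range by fastforce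
      then show "span (u ` ?I) \<subseteq> A" using simple_subalgebraD(1)[OF simple] by (rule span_minimal)
      have "x \<in> span (u ` ?I)" if x: "x \<in> X" for x
      proof -
        obtain j d where j: "j \<in> {1..m}" "d \<in> Rs j" "x = \<phi> d" using x by (auto simp: X_def)
        show ?thesis
        proof (cases "j \<in> ?I")
          case True
          obtain c where "x = c *s u j" using line[OF True j(2)] j(3) by blast
          then show ?thesis using span_scale[OF span_base[OF imageI[OF True]]] by simp
        next
          case False
          then have "x = 0" using j by blast
          then show ?thesis by (simp add: span_zero)
        qed
      qed
      then have "X \<subseteq> span (u ` ?I)" by blast
      then show "A \<subseteq> span (u ` ?I)"
        unfolding span_X[symmetric] by (intro span_minimal subspace_span)
    qed
  qed
  then show ?thesis by blast
qed

end

locale decomposed_quantum_commutative_algebra =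
  alg_closed_algebra scale Basis + regular_quantum_commutative_algebra scale m Rs \<theta>
  for scale :: "'k::alg_closed_field \<Rightarrow> 'r::ring_1 \<Rightarrow> 'r" (infixr "*s" 75) and Basis :: "'r set"
    and m :: nat and Rs :: "nat \<Rightarrow> 'r set" and \<theta> :: "nat \<Rightarrow> nat \<Rightarrow> 'k" +
  fixes B :: "'r set" and k :: nat and Bs :: "nat \<Rightarrow> 'r set"
  assumes wm: "wedderburn_malcev B" and sd: "simple_decomposition B k Bs"
begin

abbreviation families :: "(nat \<Rightarrow> 'r) set" where "families \<equiv> \<Pi>\<^sub>E t\<in>{1..k}. Bs t"

lemma simple_Bs: "t \<in> {1..k} \<Longrightarrow> simple_subalgebra (Bs t)"
  using sd by (simp add: simple_decomposition_def)

lemmas Bs = simple_subalgebraD[OF simple_Bs]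

lemma Bs_orthogonal: "s \<in> {1..k} \<Longrightarrow> t \<in> {1..k} \<Longrightarrow> s \<noteq> t \<Longrightarrow> x \<in> Bs s \<Longrightarrow> y \<in> Bs t \<Longrightarrow> x * y = 0"
  using sd by (simp add: simple_decomposition_def)

lemma subspace_radical: "subspace radical"
  by (rule left_ideal_subspace[OF radical_left_ideal])

text \<open>
  The Wedderburn--Malcev decomposition and the splitting of \<open>B\<close> combine into unique components in the
  \<open>Bs t\<close>, modulo the radical.
\<close>
lemma ex1_components: "\<exists>!f. f \<in> families \<and> x - (\<Sum>t\<in>{1..k}. f t) \<in> radical"
proof -
  have sum: "bij_betw (\<lambda>f. \<Sum>t\<in>{1..k}. f t) families B"
    using sd by (simp add: simple_decomposition_def internal_direct_sum_def)
  have split: "bij_betw (\<lambda>(b, r). b + r) (B \<times> radical) UNIV"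
    using wm by (simp add: wedderburn_malcev_def)
  have "x \<in> (\<lambda>(b, r). b + r) ` (B \<times> radical)" using split by (simp add: bij_betw_def)
  then obtain b r where b: "b \<in> B" "r \<in> radical" "x = b + r" by auto
  have "b \<in> (\<lambda>f. \<Sum>t\<in>{1..k}. f t) ` families" using sum b(1) by (simp add: bij_betw_def)
  then obtain f where f: "f \<in> families" "b = (\<Sum>t\<in>{1..k}. f t)" by blast
  show ?thesis
  proof (rule ex1I[of _ f])
    show "f \<in> families \<and> x - (\<Sum>t\<in>{1..k}. f t) \<in> radical" using f b by simp
    fix g
    assume g: "g \<in> families \<and> x - (\<Sum>t\<in>{1..k}. g t) \<in> radical"
    define s where "s = x - (\<Sum>t\<in>{1..k}. g t)"
    have gB: "(\<Sum>t\<in>{1..k}. g t) \<in> B" using sum g by (auto simp: bij_betw_def)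
    have "inj_on (\<lambda>(b, r). b + r) (B \<times> radical)" using split by (simp add: bij_betw_def)
    then have "(b, r) = (\<Sum>t\<in>{1..k}. g t, s)"
      by (rule inj_onD) (use b g gB in \<open>auto simp: s_def\<close>)
    then have "(\<Sum>t\<in>{1..k}. g t) = (\<Sum>t\<in>{1..k}. f t)" using f by simp
    then show "g = f" using sum f(1) g unfolding bij_betw_def by (auto dest: inj_onD)
  qed
qed

text \<open>
  For fixed \<open>t \<in> {1..k}\<close> the map \<open>x \<mapsto> components x t\<close> is the quotient map of \<open>R\<close> onto its simple
  factor \<open>Bs t\<close>.
\<close>
definition components :: "'r \<Rightarrow> nat \<Rightarrow> 'r" where
  "components x = (THE f. f \<in> families \<and> x - (\<Sum>t\<in>{1..k}. f t) \<in> radical)"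

lemma components: "components x \<in> families" "x - (\<Sum>t\<in>{1..k}. components x t) \<in> radical"
  using theI'[OF ex1_components[of x]] by (auto simp: components_def)

lemma components_in: "t \<in> {1..k} \<Longrightarrow> components x t \<in> Bs t"
  using components(1) by (rule PiE_mem)

lemma componentsI:
  assumes f: "\<And>t. t \<in> {1..k} \<Longrightarrow> f t \<in> Bs t" and rad: "x - (\<Sum>t\<in>{1..k}. f t) \<in> radical"
    and t: "t \<in> {1..k}"
  shows "components x t = f t"
proof -
  have "components x = restrict f {1..k}"
    unfolding components_def
    by (rule the1_equality[OF ex1_components]) (use f rad in simp)
  then show ?thesis using t by simp
qed

lemma radicalI: "(\<And>t. t \<in> {1..k} \<Longrightarrow> components x t = 0) \<Longrightarrow> x \<in> radical"
  using components(2)[of x] by simp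

lemma components_add:
  assumes t: "t \<in> {1..k}"
  shows "components (x + y) t = components x t + components y t"
proof (rule componentsI[OF _ _ t])
  show "components x t + components y t \<in> Bs t" if "t \<in> {1..k}" for t
    using that by (intro subspace_add[OF Bs(1)] components_in)
  have "(x - (\<Sum>t\<in>{1..k}. components x t)) + (y - (\<Sum>t\<in>{1..k}. components y t)) \<in> radical"
    by (intro subspace_add[OF subspace_radical] components)
  then show "x + y - (\<Sum>t\<in>{1..k}. components x t + components y t) \<in> radical"
    by (simp add: sum.distrib algebra_simps)
qed

lemma components_scale:
  assumes t: "t \<in> {1..k}"
  shows "components (c *s x) t = c *s components x t"
proof (rule componentsI[OF _ _ t])
  show "c *s components x t \<in> Bs t" if "t \<in> {1..k}" for t
    using that by (intro subspace_scale[OF Bs(1)] components_in)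
  have "c *s (x - (\<Sum>t\<in>{1..k}. components x t)) \<in> radical"
    by (intro subspace_scale[OF subspace_radical] components)
  then show "c *s x - (\<Sum>t\<in>{1..k}. c *s components x t) \<in> radical"
    by (simp add: scale_right_diff_distrib scale_sum_right)
qed

lemma components_mult:
  assumes t: "t \<in> {1..k}"
  shows "components (x * y) t = components x t * components y t"
proof (rule componentsI[OF _ _ t])
  show "components x t * components y t \<in> Bs t" if "t \<in> {1..k}" for t
    using that by (intro Bs(2) components_in)
  define b where "b = (\<Sum>t\<in>{1..k}. components x t)"
  define c where "c = (\<Sum>t\<in>{1..k}. components y t)"
  have "b * c = (\<Sum>s\<in>{1..k}. \<Sum>t\<in>{1..k}. components x s * components y t)"
    unfolding b_def c_def by (rule sum_product)
  also have "\<dots> = (\<Sum>s\<in>{1..k}. \<Sum>t\<in>{1..k}. if s = t then components x s * components y s else 0)"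
  proof (intro sum.cong refl)
    fix s t
    assume "s \<in> {1..k}" "t \<in> {1..k}"
    then show "components x s * components y t
        = (if s = t then components x s * components y s else 0)"
      using Bs_orthogonal components_in by (cases "s = t") auto
  qed
  also have "\<dots> = (\<Sum>s\<in>{1..k}. components x s * components y s)" by simp
  finally have bc: "b * c = (\<Sum>s\<in>{1..k}. components x s * components y s)" .
  have "(x - b) * y + b * (y - c) \<in> radical"
    using components(2) unfolding b_def c_def
    by (intro subspace_add[OF subspace_radical] radical_right_ideal
        left_ideal_mult[OF radical_left_ideal])
  moreover have "(x - b) * y + b * (y - c) = x * y - b * c" by (simp add: algebra_simps)
  ultimately show "x * y - (\<Sum>t\<in>{1..k}. components x t * components y t) \<in> radical"
    by (simp add: bc)
qed

lemma components_of_Bs: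
  assumes t: "t \<in> {1..k}" and b: "b \<in> Bs t"
  shows "components b t = b"
proof -
  have "components b t = (if t = t then b else 0)"
  proof (rule componentsI[where f = "\<lambda>s. if s = t then b else 0", OF _ _ t])
    show "(if s = t then b else 0) \<in> Bs s" if "s \<in> {1..k}" for s
      using that b subspace_0[OF Bs(1)] by auto
    show "b - (\<Sum>s\<in>{1..k}. if s = t then b else 0) \<in> radical"
      using t subspace_0[OF subspace_radical] by simp
  qed
  then show ?thesis by simp
qed

definition supp :: "nat \<Rightarrow> nat set" where
  "supp t = {i\<in>{1..m}. \<exists>a\<in>Rs i. components a t \<noteq> 0}"

lemma quantum_simple_Bs:
  assumes t: "t \<in> {1..k}"
  shows "\<exists>u. quantum_simple_algebra scale Basis (Bs t) (supp t) u \<theta>"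
  unfolding supp_def
proof (rule simple_quotient_quantum_simple_algebra)
  show "regular_quantum_commutative_algebra scale m Rs \<theta>" by unfold_locales
  show "simple_subalgebra (Bs t)" using t by (rule simple_Bs)
  show "Vector_Spaces.linear scale scale (\<lambda>x. components x t)"
    by unfold_locales (rule components_add[OF t] components_scale[OF t])+
  show "range (\<lambda>x. components x t) = Bs t"
  proof
    show "Bs t \<subseteq> range (\<lambda>x. components x t)"
      using components_of_Bs[OF t] by (metis rangeI subsetI)
  qed (use components_in[OF t] in blast)
qed (rule components_mult[OF t])

text \<open>
  Otherwise choose for each \<open>t\<close> an index \<open>i t\<close> such that \<open>Rs (i t)\<close> is mapped to zero in \<open>Bs t\<close>. Products
  along the word \<open>i 1, \<dots>, i k\<close> have no nonzero component and thus lie in the radical. Repeating the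
  word more often than the dimension of the algebra makes all products vanish, contrary to
  regularity.
\<close>
lemma full_support: "\<exists>l\<in>{1..k}. supp l = {1..m}"
proof (rule ccontr)
  assume none: "\<not> (\<exists>l\<in>{1..k}. supp l = {1..m})"
  define i where "i t = (SOME i. i \<in> {1..m} - supp t)" for t
  have "i t \<in> {1..m} - supp t" if t: "t \<in> {1..k}" for t
  proof -
    have "supp t \<subseteq> {1..m}" "supp t \<noteq> {1..m}" using none t by (auto simp: supp_def)
    then have "\<exists>i. i \<in> {1..m} - supp t" by blast
    then show ?thesis unfolding i_def by (rule someI_ex)
  qed
  then have i: "\<And>t. t \<in> {1..k} \<Longrightarrow> i t \<in> {1..m}"
    "\<And>t a. t \<in> {1..k} \<Longrightarrow> a \<in> Rs (i t) \<Longrightarrow> components a t = 0"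
    by (auto simp: supp_def)
  define js where "js = map i [1..<Suc k]"
  have block: "prod_list as \<in> radical" if as: "list_all2 (\<lambda>a j. a \<in> Rs j) as js" for as
  proof (rule radicalI)
    fix t
    assume t: "t \<in> {1..k}"
    have len: "length as = k" using as by (auto simp: js_def dest: list_all2_lengthD)
    \<comment> \<open>summands are numbered from 1, list positions from 0\<close>
    define n where "n = t - 1"
    have n: "n < k" using t by (auto simp: n_def)
    have "js ! n = i t" using n t by (simp add: js_def n_def del: upt_Suc)
    then have "as ! n \<in> Rs (i t)"
      using list_all2_nthD[OF as, of n] len n by simp
    then have z: "components (as ! n) t = 0" using i(2)[OF t] by blast
    have "prod_list as = prod_list (take n as) * (as ! n * prod_list (drop (Suc n) as))"
      using id_take_nth_drop[of n as] len n
      by (metis prod_list.Cons prod_list.append)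
    then show "components (prod_list as) t = 0" using z by (simp add: components_mult[OF t])
  qed
  have blocks: "\<exists>zs. prod_list as = prod_list zs \<and> set zs \<subseteq> radical \<and> length zs = N"
    if "list_all2 (\<lambda>a j. a \<in> Rs j) as (concat (replicate N js))" for as N
    using that
  proof (induction N arbitrary: as)
    case 0
    then show ?case by simp
  next
    case (Suc N)
    then obtain bs cs where bc: "as = bs @ cs" "list_all2 (\<lambda>a j. a \<in> Rs j) bs js"
      "list_all2 (\<lambda>a j. a \<in> Rs j) cs (concat (replicate N js))"
      by (auto simp: list_all2_append2)
    obtain zs where "prod_list cs = prod_list zs" "set zs \<subseteq> radical" "length zs = N"
      using Suc.IH[OF bc(3)] by blast
    then show ?case
      using block[OF bc(2)] bc(1) by (intro exI[of _ "prod_list bs # zs"]) simp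
  qed
  have "set js \<subseteq> {1..m}"
    unfolding js_def set_map set_upt atLeastLessThanSuc_atLeastAtMost using i(1) by blast
  then have js: "set (concat (replicate (Suc dimension) js)) \<subseteq> {1..m}"
    unfolding set_concat set_replicate_Suc by blast
  obtain as where as: "list_all2 (\<lambda>a j. a \<in> Rs j) as (concat (replicate (Suc dimension) js))"
    "prod_list as \<noteq> 0"
    using regular[OF js] by blast
  obtain zs where "prod_list as = prod_list zs" "set zs \<subseteq> radical" "length zs = Suc dimension"
    using blocks[OF as(1)] by blast
  then show False using as(2) radical_nilpotent[of zs] by simp
qed

theorem simple_components:
  shows "t \<in> {1..k} \<Longrightarrow> \<exists>n. dim (Bs t) = n\<^sup>2"
    and "t \<in> {1..k} \<Longrightarrow> dim (Bs t) \<le> m"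
    and "\<exists>l\<in>{1..k}. dim (Bs l) > 0 \<and> (\<forall>t\<in>{1..k}. dim (Bs t) dvd dim (Bs l))"
proof -
  show "\<exists>n. dim (Bs t) = n\<^sup>2" "dim (Bs t) \<le> m" if t: "t \<in> {1..k}" for t
  proof -
    obtain u where "quantum_simple_algebra scale Basis (Bs t) (supp t) u \<theta>"
      using quantum_simple_Bs[OF t] by blast
    then interpret Q: quantum_simple_algebra scale Basis "Bs t" "supp t" u \<theta> .
    show "\<exists>n. dim (Bs t) = n\<^sup>2" by (rule Q.dim_square)
    have "card (supp t) \<le> card {1..m}" by (intro card_mono) (auto simp: supp_def)
    then show "dim (Bs t) \<le> m" using Q.dim_le_card_I by simp
  qed
  obtain l where l: "l \<in> {1..k}" "supp l = {1..m}" using full_support by blast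
  obtain u where "quantum_simple_algebra scale Basis (Bs l) (supp l) u \<theta>"
    using quantum_simple_Bs[OF l(1)] by blast
  then interpret L: quantum_simple_algebra scale Basis "Bs l" "supp l" u \<theta> .
  have "dim (Bs t) dvd dim (Bs l)" if t: "t \<in> {1..k}" for t
  proof -
    obtain v where "quantum_simple_algebra scale Basis (Bs t) (supp t) v \<theta>"
      using quantum_simple_Bs[OF t] by blast
    then interpret T: quantum_simple_algebra scale Basis "Bs t" "supp t" v \<theta> .
    have "supp t \<subseteq> supp l" unfolding l(2) by (auto simp: supp_def)
    then show ?thesis
      unfolding T.dim_eq_card_word_chars L.dim_eq_card_word_chars
      by (intro card_word_chars_dvd L.finite_word_chars L.theta_nz)
  qed
  moreover have "dim (Bs l) > 0"
    unfolding L.dim_eq_card_word_chars card_gt_0_iff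
    using L.finite_word_chars by (auto simp: word_chars_def)
  ultimately show "\<exists>l\<in>{1..k}. dim (Bs l) > 0 \<and> (\<forall>t\<in>{1..k}. dim (Bs t) dvd dim (Bs l))"
    using l(1) by blast
qed

end

theorem proposition56:
  fixes scale :: "'k::alg_closed_field \<Rightarrow> 'r::ring_1 \<Rightarrow> 'r"
    and m k :: nat
    and Rs Bs :: "nat \<Rightarrow> 'r set"
    and \<theta> :: "nat \<Rightarrow> nat \<Rightarrow> 'k"
    and B :: "'r set"
  assumes "CHAR('k) \<noteq> 2"
    and "regular_quantum_commutative_algebra scale m Rs \<theta>"
    and "unital_algebra.finite_dimensional scale"
    and "unital_algebra.wedderburn_malcev scale B"
    and "unital_algebra.simple_decomposition scale B k Bs"
  shows "\<exists>q :: nat \<Rightarrow> nat.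
    (\<forall>i\<in>{1..k}. real (q i) = sqrt (real (vector_space.dim scale (Bs i)))) \<and>
    (\<exists>l\<in>{1..k}.
      (\<forall>s\<in>{1..k}. q s \<le> q l \<and> real (q l) \<le> sqrt (real m)) \<and>
      (\<forall>s\<in>{1..k}. 1 < q s \<and> q s < q l \<longrightarrow> gcd (q s) (q l) > 1))"
proof -
  interpret R: regular_quantum_commutative_algebra scale m Rs \<theta> by fact
  obtain S where S: "finite S" "R.span S = UNIV"
    using assms(3) by (auto simp: R.finite_dimensional_def)
  obtain Basis where Basis: "Basis \<subseteq> S" "R.independent Basis" "R.span S = R.span Basis"
    using R.maximal_independent_subset[of S]
    by (metis R.span_mono R.span_span subset_antisym)
  interpret D: decomposed_quantum_commutative_algebra scale Basis m Rs \<theta> B k Bs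
    using finite_subset[OF Basis(1) S(1)] Basis S(2) assms(4,5) by unfold_locales auto
  obtain q where q: "\<And>i. i \<in> {1..k} \<Longrightarrow> R.dim (Bs i) = (q i)\<^sup>2"
    using D.simple_components(1) by metis
  obtain l where l: "l \<in> {1..k}" "R.dim (Bs l) > 0"
    and dvd: "\<And>s. s \<in> {1..k} \<Longrightarrow> R.dim (Bs s) dvd R.dim (Bs l)"
    using D.simple_components(3) by blast
  have q_dvd: "q s dvd q l" if "s \<in> {1..k}" for s
    using dvd[OF that] q[OF that] q[OF l(1)] by simp
  have "q l > 0" using l q by (metis bot_nat_0.not_eq_extremum zero_power2)
  then have "q s \<le> q l" if "s \<in> {1..k}" for s using q_dvd[OF that] by (simp add: dvd_imp_le)
  moreover have "real (q l) \<le> sqrt (real m)"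
  proof (rule real_le_rsqrt)
    have "(q l)\<^sup>2 \<le> m" using D.simple_components(2)[OF l(1)] q[OF l(1)] by simp
    then show "(real (q l))\<^sup>2 \<le> real m" by (metis of_nat_le_iff of_nat_power)
  qed
  moreover have "gcd (q s) (q l) > 1" if "s \<in> {1..k}" "1 < q s" for s
    using q_dvd[OF that(1)] that(2) by (simp add: gcd_nat.absorb1)
  moreover have "real (q i) = sqrt (real (R.dim (Bs i)))" if "i \<in> {1..k}" for i
    using q[OF that] by simp
  ultimately show ?thesis using l(1) by (intro exI[of _ q]) blast
qed

end
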